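(* Let $n\ge4$ and let $T,T'$ be trees on the vertex set $[n]$. For $r\ge1$ let $\mathcal M_r^{(2)}(T;y)$ denote the weighted trace polynomial of $T$ (in variables $y_e$, $e\in E(T)$). (i) If $n\ne7$ and there is a bijection $\psi:E(T)\to E(T')$ such that $\mathcal M_2^{(2)}(T';y)$, after substituting $y_{\psi(e)}\mapsto y_e$ for all $e\in E(T)$, equals $\mathcal M_2^{(2)}(T;y)$, then $T\cong T'$. (ii) If $n=7$ and there is a bijection $\psi:E(T)\to E(T')$ such that this substitution simultaneously transforms $\mathcal M_2^{(2)}(T';y)$ into $\mathcal M_2^{(2)}(T;y)$ and $\mathcal M_4^{(2)}(T';y)$ into $\mathcal M_4^{(2)}(T;y)$, then $T\cong T'$. In other words, for $n\neq 7$ the quadratic weighted trace polynomial, considered up to permutation of the edge variables, determines $T$ up to isomorphism, and for $n=7$ the pair of quadratic and quartic weighted trace polynomials does.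
   Context: For an edge $e=ij$ of a tree $T$ on $[n]$, $\tau_e=(ij)\in S_n$. Introduce independent variables $y_e$, $e\in E(T)$, set $X_T(y)=\sum_{e\in E(T)}y_e\tau_e\in\mathbb C[y_e:e\in E(T)][S_n]$, and define $\mathcal M_r^{(2)}(T;y)=\operatorname{tr}_{(n-2,2)}(X_T(y)^r)$, the trace of $X_T(y)^r$ acting on the irreducible representation of $S_n$ indexed by the partition $(n-2,2)$ (coefficients extended to the polynomial ring). *)

theory Defs
  imports Complex_Main "HOL-Library.Poly_Mapping" "HOL-Combinatorics.Permutations"
begin

section \<open>Simple graphs and trees\<close>

text \<open>A simple graph is given by a vertex set \<open>V\<close> and a set \<open>E\<close> of edges, each edge being a
  two-element set of vertices.\<close>

definition simple_graph :: "'a set \<Rightarrow> 'a set set \<Rightarrow> bool" where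
  "simple_graph V E \<longleftrightarrow> finite V \<and> (\<forall>e\<in>E. e \<subseteq> V \<and> card e = 2)"

definition graph_connected :: "'a set \<Rightarrow> 'a set set \<Rightarrow> bool" where
  "graph_connected V E \<longleftrightarrow> V \<noteq> {} \<and> (\<forall>u\<in>V. \<forall>v\<in>V. (u, v) \<in> {(a, b). {a, b} \<in> E}\<^sup>*)"

definition graph_cycle :: "'a set set \<Rightarrow> 'a list \<Rightarrow> bool" where
  "graph_cycle E c \<longleftrightarrow> 3 \<le> length c \<and> distinct c \<and>
     (\<forall>i<length c. {c ! i, c ! (Suc i mod length c)} \<in> E)"

definition is_tree :: "'a set \<Rightarrow> 'a set set \<Rightarrow> bool" where
  "is_tree V E \<longleftrightarrow> simple_graph V E \<and> graph_connected V E \<and> (\<nexists>c. graph_cycle E c)"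

definition graph_iso :: "'a set \<Rightarrow> 'a set set \<Rightarrow> 'b set \<Rightarrow> 'b set set \<Rightarrow> bool" where
  "graph_iso V E V' E' \<longleftrightarrow>
     (\<exists>\<phi>. bij_betw \<phi> V V' \<and> (\<forall>u\<in>V. \<forall>v\<in>V. {u, v} \<in> E \<longleftrightarrow> {\<phi> u, \<phi> v} \<in> E'))"

section \<open>Complex polynomials in variables indexed by a type\<close>

text \<open>A polynomial maps monomials (finitely supported exponent functions) to coefficients; the
  commutative ring structure is the convolution structure of \<^theory>\<open>HOL-Library.Poly_Mapping\<close>.\<close>

type_synonym 'x cpoly = "('x \<Rightarrow>\<^sub>0 nat) \<Rightarrow>\<^sub>0 complex"

definition Const :: "complex \<Rightarrow> 'x cpoly" where
  "Const c = Poly_Mapping.single 0 c"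

definition Var :: "'x \<Rightarrow> 'x cpoly" where
  "Var x = Poly_Mapping.single (Poly_Mapping.single x 1) 1"

definition poly_subst :: "('x \<Rightarrow> 'z cpoly) \<Rightarrow> 'x cpoly \<Rightarrow> 'z cpoly" where
  "poly_subst \<sigma> P =
     (\<Sum>m\<in>Poly_Mapping.keys P. Const (Poly_Mapping.lookup P m) *
        (\<Prod>x\<in>Poly_Mapping.keys m. \<sigma> x ^ Poly_Mapping.lookup m x))"

section \<open>Free complex vector spaces\<close>

text \<open>\<open>'b \<Rightarrow>\<^sub>0 complex\<close> is the space of formal linear combinations of elements of \<open>'b\<close>.\<close>

definition cscale :: "complex \<Rightarrow> ('b \<Rightarrow>\<^sub>0 complex) \<Rightarrow> ('b \<Rightarrow>\<^sub>0 complex)" where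
  "cscale c v = Poly_Mapping.map ((*) c) v"

lemma lookup_cscale [simp]: "Poly_Mapping.lookup (cscale c v) k = c * Poly_Mapping.lookup v k"
  unfolding cscale_def by (simp add: Poly_Mapping.map.rep_eq when_def)

interpretation freeC: vector_space "cscale :: complex \<Rightarrow> ('b \<Rightarrow>\<^sub>0 complex) \<Rightarrow> _"
  by unfold_locales (auto intro!: poly_mapping_eqI simp: lookup_add algebra_simps)

section \<open>Specht modules\<close>

text \<open>A partition of \<open>n\<close> is a weakly decreasing list \<open>\<mu>\<close> of positive parts with sum \<open>n\<close>. A tableau is
  a bijective filling of the cells of its Young diagram by \<open>1, \<dots>, n\<close> (values outside the diagram
  are irrelevant); the tabloid of a tableau is the list of the sets of entries of its rows.\<close>

definition cells :: "nat list \<Rightarrow> (nat \<times> nat) set" where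
  "cells \<mu> = {(i, j). i < length \<mu> \<and> j < \<mu> ! i}"

definition tableau :: "nat list \<Rightarrow> (nat \<times> nat \<Rightarrow> nat) \<Rightarrow> bool" where
  "tableau \<mu> t \<longleftrightarrow> bij_betw t (cells \<mu>) {1..sum_list \<mu>}"

definition tabloid :: "nat list \<Rightarrow> (nat \<times> nat \<Rightarrow> nat) \<Rightarrow> nat set list" where
  "tabloid \<mu> t = map (\<lambda>i. {t (i, j) | j. (i, j) \<in> cells \<mu>}) [0..<length \<mu>]"

definition column_stabilizer :: "nat list \<Rightarrow> (nat \<times> nat \<Rightarrow> nat) \<Rightarrow> (nat \<Rightarrow> nat) set" where
  "column_stabilizer \<mu> t =
     {p. p permutes {1..sum_list \<mu>} \<and>
         (\<forall>j. p ` {t (i, j) | i. (i, j) \<in> cells \<mu>} = {t (i, j) | i. (i, j) \<in> cells \<mu>})}"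

definition polytabloid :: "nat list \<Rightarrow> (nat \<times> nat \<Rightarrow> nat) \<Rightarrow> (nat set list \<Rightarrow>\<^sub>0 complex)" where
  "polytabloid \<mu> t =
     (\<Sum>p\<in>column_stabilizer \<mu> t. Poly_Mapping.single (tabloid \<mu> (p \<circ> t)) (of_int (sign p)))"

text \<open>The Specht module is the irreducible representation of the symmetric group indexed by \<open>\<mu>\<close>, as
  a subspace of the space spanned by the tabloids.\<close>

definition specht :: "nat list \<Rightarrow> (nat set list \<Rightarrow>\<^sub>0 complex) set" where
  "specht \<mu> = freeC.span {polytabloid \<mu> t | t. tableau \<mu> t}"

definition perm_act :: "(nat \<Rightarrow> nat) \<Rightarrow> (nat set list \<Rightarrow>\<^sub>0 complex) \<Rightarrow> (nat set list \<Rightarrow>\<^sub>0 complex)" where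
  "perm_act p v =
     (\<Sum>S\<in>Poly_Mapping.keys v. Poly_Mapping.single (map ((`) p) S) (Poly_Mapping.lookup v S))"

section \<open>Group algebra of the symmetric group over a polynomial ring\<close>

text \<open>An element is given by its coefficient function on the permutations of \<open>{1..n}\<close>.\<close>

definition ga_mult ::
  "nat \<Rightarrow> ((nat \<Rightarrow> nat) \<Rightarrow> 'r::comm_ring_1) \<Rightarrow> ((nat \<Rightarrow> nat) \<Rightarrow> 'r) \<Rightarrow> ((nat \<Rightarrow> nat) \<Rightarrow> 'r)" where
  "ga_mult n a b =
     (\<lambda>p. \<Sum>(q, s) | q permutes {1..n} \<and> s permutes {1..n} \<and> q \<circ> s = p. a q * b s)"

definition ga_one :: "(nat \<Rightarrow> nat) \<Rightarrow> 'r::comm_ring_1" where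
  "ga_one = (\<lambda>p. 1 when p = id)"

definition ga_power ::
  "nat \<Rightarrow> ((nat \<Rightarrow> nat) \<Rightarrow> 'r::comm_ring_1) \<Rightarrow> nat \<Rightarrow> ((nat \<Rightarrow> nat) \<Rightarrow> 'r)" where
  "ga_power n a r = (ga_mult n a ^^ r) ga_one"

text \<open>The trace of a group algebra element \<open>a\<close> with polynomial coefficients on the module obtained
  from a finite-dimensional invariant subspace \<open>W\<close> by extension of scalars: the sum of the diagonal
  matrix entries of \<open>a\<close> with respect to a complex basis \<open>B\<close> of \<open>W\<close>, which is also a basis of the
  extended module. The value does not depend on the chosen basis.\<close>

definition ga_trace ::
  "nat \<Rightarrow> (nat set list \<Rightarrow>\<^sub>0 complex) set \<Rightarrow> ((nat \<Rightarrow> nat) \<Rightarrow> 'x cpoly) \<Rightarrow> 'x cpoly" where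
  "ga_trace n W a =
     (let B = (SOME B. freeC.independent B \<and> freeC.span B = W)
      in \<Sum>b\<in>B. \<Sum>p | p permutes {1..n}. a p * Const (freeC.representation B (perm_act p b) b))"

section \<open>Weighted trace polynomials\<close>

definition edge_transp :: "nat set \<Rightarrow> nat \<Rightarrow> nat" where
  "edge_transp e = transpose (Min e) (Max e)"

definition X_elem :: "nat set set \<Rightarrow> (nat \<Rightarrow> nat) \<Rightarrow> nat set cpoly" where
  "X_elem E = (\<lambda>p. \<Sum>e\<in>E. (Var e when edge_transp e = p))"

text \<open>The variables are the edges themselves. Only variables \<open>y\<^sub>e\<close> with \<open>e \<in> E\<close> occur.\<close>

definition trace_poly2 :: "nat \<Rightarrow> nat set set \<Rightarrow> nat \<Rightarrow> nat set cpoly" where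
  "trace_poly2 n E r = ga_trace n (specht [n - 2, 2]) (ga_power n (X_elem E) r)"

text \<open>The effect of substituting \<open>y\<^sub>e\<close> for \<open>y\<^bsub>\<psi>(e)\<^esub>\<close>, for all \<open>e \<in> E\<close>.\<close>

definition edge_subst ::
  "(nat set \<Rightarrow> nat set) \<Rightarrow> nat set set \<Rightarrow> nat set cpoly \<Rightarrow> nat set cpoly" where
  "edge_subst \<psi> E = poly_subst (\<lambda>f. Var (inv_into E \<psi> f))"

end

theory Submission
  imports Defs
begin

text \<open>Realise the representation \<open>(n - 2, 2)\<close> as the edge weights on the complete graph whose sum at
  every vertex vanishes. Its character at \<open>p\<close> is \<open>(a\<^sup>2 - 4 a + g) / 2\<close>, where \<open>a\<close> and \<open>g\<close> count the
  fixed points of \<open>p\<close> and of \<open>p \<circ> p\<close>. The values at a product of two disjoint and of two adjacent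
  transpositions differ by \<open>n - 7\<close>, so for \<open>n \<noteq> 7\<close> the coefficient of \<open>y\<^sub>e y\<^sub>f\<close> in the quadratic trace
  polynomial tells whether \<open>e\<close> and \<open>f\<close> are adjacent. In the quartic one the coefficient of
  \<open>y\<^sub>e\<^sup>2 y\<^sub>f\<^sup>2\<close> does so for every \<open>n\<close>, since \<open>(\<tau>\<^sub>e \<tau>\<^sub>f)\<^sup>2\<close> is the identity or a 3-cycle. Hence \<open>\<psi>\<close> is an
  isomorphism of line graphs. As trees have no triangles, cliques of edges are stars, and \<open>\<psi>\<close> is
  induced by a bijection of the vertices.\<close>

section \<open>Line graphs of trees\<close>

definition star :: "'a set set \<Rightarrow> 'a \<Rightarrow> 'a set set" where
  "star E v = {e \<in> E. v \<in> e}"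

lemma tree_edgeD:
  assumes "is_tree V E" "e \<in> E"
  shows "e \<subseteq> V" "card e = 2"
  using assms by (auto simp: is_tree_def simple_graph_def)

lemma card_2_eqI:
  assumes "card e = 2" "x \<in> e" "y \<in> e" "x \<noteq> y"
  shows "e = {x, y}"
  using assms by (auto simp: card_2_iff)

lemma card_2_obtain:
  assumes "card e = 2" "x \<in> e"
  obtains y where "e = {x, y}" "x \<noteq> y"
  using assms by (auto simp: card_2_iff doubleton_eq_iff)

lemma tree_no_triangle:
  assumes "is_tree V E" "{a, b} \<in> E" "{b, c} \<in> E" "{c, a} \<in> E" "distinct [a, b, c]"
  shows False
proof -
  have "{[a, b, c] ! i, [a, b, c] ! (Suc i mod 3)} \<in> E" if "i < 3" for i
  proof -
    have "i = 0 \<or> i = 1 \<or> i = 2"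
      using that by linarith
    then show ?thesis
      using assms(2-4) by (elim disjE) (simp_all add: numeral_2_eq_2)
  qed
  then have "graph_cycle E [a, b, c]"
    using assms(5) by (simp add: graph_cycle_def)
  then show False
    using assms(1) by (auto simp: is_tree_def)
qed

text \<open>If distinct \<open>u\<close> and \<open>v\<close> had the same star, every edge meeting
  \<open>{u, v}\<close> would be \<open>{u, v}\<close> itself, and no path could reach a third
  vertex. The bound on \<open>card V\<close> excludes the single edge, whose two ends do share their
  star.\<close>

lemma tree_star_inj:
  assumes T: "is_tree V E" and V: "card V \<ge> 3"
    and uv: "u \<in> V" "v \<in> V" "star E u = star E v"
  shows "u = v"
proof (rule ccontr)
  assume "u \<noteq> v"
  have sub: "e = {u, v}" if "e \<in> E" "u \<in> e \<or> v \<in> e" for e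
    using that uv(3) \<open>u \<noteq> v\<close> card_2_eqI[OF tree_edgeD(2)[OF T \<open>e \<in> E\<close>]]
    by (auto simp: star_def)
  have "\<exists>w\<in>V. w \<notin> {u, v}"
  proof (rule ccontr)
    assume "\<not> ?thesis"
    then have "card V \<le> card {u, v}"
      by (intro card_mono) auto
    then show False
      using V \<open>u \<noteq> v\<close> by simp
  qed
  then obtain w where w: "w \<in> V" "w \<notin> {u, v}"
    by blast
  have "x \<in> {u, v}" if "(u, x) \<in> {(a, b). {a, b} \<in> E}\<^sup>*" for x
    using that
  proof (induction rule: rtrancl_induct)
    case (step y z)
    then have "{y, z} = {u, v}"
      using sub by blast
    then show ?case
      by blast
  qed simp
  then show False
    using T uv(1) w by (auto simp: is_tree_def graph_connected_def)
qed

lemma tree_star_nonempty: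
  assumes T: "is_tree V E" and V: "card V \<ge> 3" and v: "v \<in> V"
  shows "star E v \<noteq> {}"
proof -
  have "\<exists>w\<in>V. w \<noteq> v"
  proof (rule ccontr)
    assume "\<not> ?thesis"
    then have "card V \<le> card {v}"
      by (intro card_mono) auto
    then show False
      using V by simp
  qed
  then obtain w where w: "w \<in> V" "w \<noteq> v"
    by blast
  then have "(v, w) \<in> {(a, b). {a, b} \<in> E}\<^sup>*"
    using T v by (auto simp: is_tree_def graph_connected_def)
  then obtain x where "{v, x} \<in> E"
    using w(2) by (cases rule: converse_rtranclE) auto
  then show ?thesis
    by (auto simp: star_def)
qed

text \<open>Otherwise three of the edges would form a triangle.\<close>

lemma tree_clique_in_star:
  assumes T: "is_tree V E" and C: "C \<subseteq> E" "e \<in> C" "f \<in> C" "e \<noteq> f"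
    and adj: "\<And>g h. g \<in> C \<Longrightarrow> h \<in> C \<Longrightarrow> g \<inter> h \<noteq> {}"
  shows "\<exists>a\<in>V. C \<subseteq> star E a"
proof -
  have card2: "card g = 2" if "g \<in> C" for g
    using tree_edgeD(2)[OF T] C(1) that by blast
  obtain a where a: "a \<in> e" "a \<in> f"
    using adj C by blast
  obtain b where b: "e = {a, b}" "a \<noteq> b"
    using card2[OF C(2)] a(1) by (auto simp: card_2_iff)
  obtain c where c: "f = {a, c}" "a \<noteq> c"
    using card2[OF C(3)] a(2) by (auto simp: card_2_iff)
  have "a \<in> g" if g: "g \<in> C" for g
  proof (rule ccontr)
    assume "a \<notin> g"
    then have "b \<in> g" "c \<in> g"
      using adj[OF g C(2)] adj[OF g C(3)] b c by auto
    then have "g = {b, c}"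
      using card_2_eqI[OF card2[OF g]] b c C(4) by blast
    then show False
      using tree_no_triangle[OF T, of a b c] b c C g by (auto simp: insert_commute)
  qed
  moreover have "a \<in> V"
    using tree_edgeD(1)[OF T] C a by blast
  ultimately show ?thesis
    using C(1) by (auto simp: star_def)
qed

section \<open>Line graph isomorphisms carry stars to stars\<close>

text \<open>The quantifiers include \<open>e = f\<close>, so that pairwise meeting families of
  edges, as in \<open>tree_clique_in_star\<close>, transfer without a case distinction.\<close>

definition line_graph_iso :: "('a set \<Rightarrow> 'b set) \<Rightarrow> 'a set set \<Rightarrow> 'b set set \<Rightarrow> bool" where
  "line_graph_iso \<psi> E E' \<longleftrightarrow> bij_betw \<psi> E E' \<and>
     (\<forall>e\<in>E. \<forall>f\<in>E. e \<inter> f = {} \<longleftrightarrow> \<psi> e \<inter> \<psi> f = {})"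

lemma line_graph_iso_inv:
  assumes "line_graph_iso \<psi> E E'"
  shows "line_graph_iso (inv_into E \<psi>) E' E"
proof -
  have \<psi>: "bij_betw \<psi> E E'" "\<And>e f. e \<in> E \<Longrightarrow> f \<in> E \<Longrightarrow> e \<inter> f = {} \<longleftrightarrow> \<psi> e \<inter> \<psi> f = {}"
    using assms by (auto simp: line_graph_iso_def)
  have "inv_into E \<psi> g \<in> E" "\<psi> (inv_into E \<psi> g) = g" if "g \<in> E'" for g
    using that \<psi>(1) by (simp_all add: bij_betw_def f_inv_into_f inv_into_into)
  then show ?thesis
    using \<psi> bij_betw_inv_into[OF \<psi>(1)] by (auto simp: line_graph_iso_def)
qed

text \<open>The edges at \<open>v\<close> meet pairwise in \<open>v\<close>, so their images form a
  clique; having two distinct members, it lies in a star of the other tree.\<close>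

lemma line_graph_iso_image_star:
  assumes T: "is_tree V E" and T': "is_tree V' E'" and \<psi>: "line_graph_iso \<psi> E E'"
    and ef: "e \<in> star E v" "f \<in> star E v" "e \<noteq> f"
  shows "\<exists>v'\<in>V'. \<psi> ` star E v \<subseteq> star E' v'"
proof -
  have bij: "bij_betw \<psi> E E'" and adj: "\<And>e f. e \<in> E \<Longrightarrow> f \<in> E \<Longrightarrow> e \<inter> f = {} \<longleftrightarrow> \<psi> e \<inter> \<psi> f = {}"
    using \<psi> by (auto simp: line_graph_iso_def)
  show ?thesis
  proof (rule tree_clique_in_star[OF T'])
    show "\<psi> ` star E v \<subseteq> E'"
      using bij by (auto simp: bij_betw_def star_def)
    show "\<psi> e \<in> \<psi> ` star E v" "\<psi> f \<in> \<psi> ` star E v"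
      using ef by auto
    show "\<psi> e \<noteq> \<psi> f"
      using ef bij by (auto simp: bij_betw_def star_def inj_on_eq_iff)
    show "g \<inter> h \<noteq> {}" if gh: "g \<in> \<psi> ` star E v" "h \<in> \<psi> ` star E v" for g h
    proof -
      obtain g0 h0 where "g = \<psi> g0" "h = \<psi> h0" "g0 \<in> star E v" "h0 \<in> star E v"
        using gh by blast
      then show ?thesis
        using adj[of g0 h0] by (auto simp: star_def)
    qed
  qed
qed

text \<open>The inclusion is applied again to the inverse: the star at \<open>v'\<close> returns
  into the star of some \<open>w\<close>. Both \<open>v\<close> and \<open>w\<close> lie on the
  distinct edges \<open>e\<close> and \<open>f\<close>, which share only one vertex, so
  \<open>w = v\<close> and the inclusion is an equality.\<close>

lemma line_graph_iso_star:
  assumes T: "is_tree V E" and T': "is_tree V' E'" and \<psi>: "line_graph_iso \<psi> E E'"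
    and ef: "e \<in> star E v" "f \<in> star E v" "e \<noteq> f"
  shows "\<exists>v'\<in>V'. \<psi> ` star E v = star E' v'"
proof -
  let ?\<chi> = "inv_into E \<psi>"
  have inj: "inj_on \<psi> E" and im: "\<psi> ` E = E'"
    using \<psi> by (auto simp: line_graph_iso_def bij_betw_def)
  have inv: "?\<chi> (\<psi> g) = g" if "g \<in> E" for g
    using inj that by simp
  have efE: "e \<in> E" "f \<in> E"
    using ef by (auto simp: star_def)
  obtain v' where v': "v' \<in> V'" "\<psi> ` star E v \<subseteq> star E' v'"
    using line_graph_iso_image_star[OF assms] by blast
  have "\<psi> e \<in> star E' v'" "\<psi> f \<in> star E' v'" "\<psi> e \<noteq> \<psi> f"
    using v' ef efE inj by (auto simp: inj_on_eq_iff)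
  then obtain w where w: "?\<chi> ` star E' v' \<subseteq> star E w"
    using line_graph_iso_image_star[OF T' T line_graph_iso_inv[OF \<psi>]] by blast
  then have "?\<chi> (\<psi> e) \<in> star E w" "?\<chi> (\<psi> f) \<in> star E w"
    using v'(2) ef by blast+
  then have "w \<in> e \<inter> f" "v \<in> e \<inter> f"
    using ef efE inv by (auto simp: star_def)
  then have "w = v"
    using card_2_eqI[OF tree_edgeD(2)[OF T efE(1)]] card_2_eqI[OF tree_edgeD(2)[OF T efE(2)]] ef(3)
    by (metis IntE)
  have "g \<in> \<psi> ` star E v" if g: "g \<in> star E' v'" for g
  proof -
    have "g \<in> E'"
      using g by (auto simp: star_def)
    then have "\<psi> (?\<chi> g) = g"
      using im by (auto simp: f_inv_into_f)
    moreover have "?\<chi> g \<in> star E v"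
      using w g \<open>w = v\<close> by blast
    ultimately show ?thesis
      by (metis imageI)
  qed
  then show ?thesis
    using v' by blast
qed

text \<open>A single edge lies in two stars, so the clique argument does not locate the centre.
  Instead the star at the other end \<open>w\<close> of the leaf edge goes to the star of some
  \<open>w'\<close>, and the second end \<open>x\<close> of \<open>\<psi> e\<close> is shown to be a
  leaf: another edge at \<open>x\<close> would come from an edge meeting \<open>e\<close>, hence
  from one at \<open>w\<close>, and would contain both \<open>w'\<close> and
  \<open>x\<close>.\<close>

lemma line_graph_iso_star_leaf:
  assumes T: "is_tree V E" and T': "is_tree V' E'" and \<psi>: "line_graph_iso \<psi> E E'"
    and V: "card V \<ge> 3" and v: "v \<in> V" and star: "star E v = {e}"
  shows "\<exists>v'\<in>V'. \<psi> ` star E v = star E' v'"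
proof -
  have inj: "inj_on \<psi> E" and im: "\<psi> ` E = E'"
    and adj: "\<And>e f. e \<in> E \<Longrightarrow> f \<in> E \<Longrightarrow> e \<inter> f = {} \<longleftrightarrow> \<psi> e \<inter> \<psi> f = {}"
    using \<psi> by (auto simp: line_graph_iso_def bij_betw_def)
  have e: "e \<in> E" "v \<in> e"
    using star by (auto simp: star_def)
  obtain w where w: "e = {v, w}" "v \<noteq> w"
    using tree_edgeD(2)[OF T e(1)] e(2) by (auto simp: card_2_iff)
  have "w \<in> V" "e \<in> star E w"
    using tree_edgeD(1)[OF T e(1)] w e by (auto simp: star_def)
  \<comment> \<open>Otherwise the two ends of \<open>e\<close> would have equal stars.\<close>
  then have "star E w \<noteq> {e}"
    using tree_star_inj[OF T V v] star w by metis
  then obtain f where "f \<in> star E w" "f \<noteq> e"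
    using \<open>e \<in> star E w\<close> by blast
  then obtain w' where w': "\<psi> ` star E w = star E' w'"
    using line_graph_iso_star[OF T T' \<psi> \<open>e \<in> star E w\<close>] by blast
  have \<psi>e: "\<psi> e \<in> E'" "w' \<in> \<psi> e"
    using w' \<open>e \<in> star E w\<close> by (auto simp: star_def)
  obtain x where x: "\<psi> e = {w', x}" "w' \<noteq> x"
    using card_2_obtain[OF tree_edgeD(2)[OF T' \<psi>e(1)] \<psi>e(2)] by blast
  have "g' = \<psi> e" if g': "g' \<in> star E' x" for g'
  proof (rule ccontr)
    assume ne: "g' \<noteq> \<psi> e"
    have "g' \<in> E'" "x \<in> g'"
      using g' by (auto simp: star_def)
    then obtain g where g: "g \<in> E" "g' = \<psi> g"
      using im by blast
    have "g \<noteq> e"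
      using ne g by blast
    then have "v \<notin> g"
      using star g by (auto simp: star_def)
    moreover have "g \<inter> e \<noteq> {}"
      using adj[OF g(1) e(1)] g(2) x \<open>x \<in> g'\<close> by auto
    ultimately have "g \<in> star E w"
      using g w by (auto simp: star_def)
    then have "w' \<in> g'"
      using w' g by (auto simp: star_def)
    then show False
      using card_2_eqI[OF tree_edgeD(2)[OF T' \<open>g' \<in> E'\<close>]] \<open>x \<in> g'\<close> x ne by blast
  qed
  moreover have "\<psi> e \<in> star E' x" "x \<in> V'"
    using \<psi>e x tree_edgeD(1)[OF T' \<psi>e(1)] by (auto simp: star_def)
  ultimately have "star E' x = {\<psi> e}"
    by blast
  then show ?thesis
    using star \<open>x \<in> V'\<close> by (intro bexI[of _ x]) auto
qed

theorem line_graph_iso_imp_graph_iso: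
  assumes T: "is_tree V E" and T': "is_tree V' E'" and \<psi>: "line_graph_iso \<psi> E E'"
    and V: "card V \<ge> 3" and card: "card V' = card V"
  shows "graph_iso V E V' E'"
proof -
  have bij: "bij_betw \<psi> E E'"
    using \<psi> by (simp add: line_graph_iso_def)
  have fin: "finite V" "finite V'"
    using T T' by (auto simp: is_tree_def simple_graph_def)
  have "\<exists>v'\<in>V'. \<psi> ` star E v = star E' v'" if v: "v \<in> V" for v
  proof -
    obtain e where e: "e \<in> star E v"
      using tree_star_nonempty[OF T V v] by blast
    show ?thesis
    proof (cases "star E v = {e}")
      case True
      then show ?thesis
        using line_graph_iso_star_leaf[OF T T' \<psi> V v] by blast
    next
      case False
      then obtain f where "f \<in> star E v" "f \<noteq> e"
        using e by blast
      then show ?thesis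
        using line_graph_iso_star[OF T T' \<psi> e] by blast
    qed
  qed
  then obtain \<phi> where \<phi>: "\<And>v. v \<in> V \<Longrightarrow> \<phi> v \<in> V'" "\<And>v. v \<in> V \<Longrightarrow> \<psi> ` star E v = star E' (\<phi> v)"
    by metis
  have "inj_on \<phi> V"
  proof (rule inj_onI)
    fix u v assume uv: "u \<in> V" "v \<in> V" "\<phi> u = \<phi> v"
    then have "\<psi> ` star E u = \<psi> ` star E v"
      using \<phi>(2) by metis
    then have "star E u = star E v"
      using bij_betw_imp_inj_on[OF bij] by (subst (asm) inj_on_image_eq_iff[of \<psi> E]) (auto simp: star_def)
    then show "u = v"
      using tree_star_inj[OF T V] uv by blast
  qed
  moreover have "\<phi> ` V = V'"
    using \<phi>(1) \<open>inj_on \<phi> V\<close> fin card by (intro card_subset_eq) (auto simp: card_image)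
  ultimately have \<phi>bij: "bij_betw \<phi> V V'"
    by (simp add: bij_betw_def)
  have \<psi>\<phi>: "\<psi> e = \<phi> ` e" if e: "e \<in> E" for e
  proof -
    have "\<phi> ` e \<subseteq> \<psi> e"
    proof
      fix x assume "x \<in> \<phi> ` e"
      then obtain v where v: "v \<in> e" "x = \<phi> v"
        by blast
      then have "v \<in> V" "e \<in> star E v"
        using tree_edgeD(1)[OF T e] e by (auto simp: star_def)
      then have "\<psi> e \<in> star E' (\<phi> v)"
        using \<phi>(2) by blast
      then show "x \<in> \<psi> e"
        using v by (auto simp: star_def)
    qed
    moreover have "card (\<phi> ` e) = 2"
      using tree_edgeD[OF T e] inj_on_subset[OF \<open>inj_on \<phi> V\<close>] by (auto simp: card_image)
    moreover have "card (\<psi> e) = 2"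
      using tree_edgeD(2)[OF T'] bij e by (auto simp: bij_betw_def)
    ultimately show ?thesis
      by (metis card_subset_eq card.infinite zero_neq_numeral)
  qed
  have "{u, v} \<in> E \<longleftrightarrow> {\<phi> u, \<phi> v} \<in> E'" if uv: "u \<in> V" "v \<in> V" for u v
  proof
    assume "{u, v} \<in> E"
    then have "\<psi> {u, v} \<in> E'"
      using bij by (auto simp: bij_betw_def)
    then show "{\<phi> u, \<phi> v} \<in> E'"
      using \<psi>\<phi>[OF \<open>{u, v} \<in> E\<close>] by simp
  next
    assume "{\<phi> u, \<phi> v} \<in> E'"
    then obtain e where e: "e \<in> E" "\<psi> e = {\<phi> u, \<phi> v}"
      using bij by (metis bij_betw_imp_surj_on imageE)
    then have "\<phi> ` e = \<phi> ` {u, v}"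
      using \<psi>\<phi> by simp
    then have "e = {u, v}"
      using inj_on_image_eq_iff[OF \<open>inj_on \<phi> V\<close>] tree_edgeD(1)[OF T e(1)] uv by blast
    then show "{u, v} \<in> E"
      using e by simp
  qed
  then show ?thesis
    using \<phi>bij by (auto simp: graph_iso_def)
qed

section \<open>The character of the representation \<open>(n - 2, 2)\<close>\<close>

text \<open>A trace can be computed from any finite family \<open>Q\<close> of vectors of \<open>W\<close> with linear coefficient
  functionals \<open>L\<close> reconstructing every vector of \<open>W\<close>; \<open>Q\<close> need not be linearly independent.\<close>

lemma sum_representation_frame:
  fixes W :: "('b \<Rightarrow>\<^sub>0 complex) set" and Q :: "'i \<Rightarrow> ('b \<Rightarrow>\<^sub>0 complex)"
  assumes B: "freeC.independent B" "freeC.span B = W"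
    and I: "finite I" "\<And>x. x \<in> I \<Longrightarrow> Q x \<in> W"
    and rec: "\<And>w. w \<in> W \<Longrightarrow> (\<Sum>x\<in>I. cscale (L x w) (Q x)) = w"
    and L: "\<And>x. Vector_Spaces.linear cscale (*) (L x)"
    and f: "Vector_Spaces.linear cscale cscale f" "f ` W \<subseteq> W"
  shows "(\<Sum>b\<in>B. freeC.representation B (f b) b) = (\<Sum>x\<in>I. L x (f (Q x)))"
    and "finite B"
proof -
  interpret f: Vector_Spaces.linear cscale cscale f by (rule f)
  have BW: "B \<subseteq> W"
    using B freeC.span_superset by blast
  \<comment> \<open>\<open>W\<close> is spanned by finitely many vectors, so the independent set
    \<open>B\<close> is finite.\<close>
  have "W \<subseteq> freeC.span (Q ` I)"
  proof
    fix w assume "w \<in> W"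
    then have "w = (\<Sum>x\<in>I. cscale (L x w) (Q x))"
      using rec by simp
    then show "w \<in> freeC.span (Q ` I)"
      by (metis (no_types, lifting) freeC.span_base freeC.span_scale freeC.span_sum imageI)
  qed
  then show finB: "finite B"
    using freeC.independent_span_bound[OF finite_imageI[OF I(1)] B(1)] BW by blast
  have rep: "freeC.representation B (f b) b = (\<Sum>x\<in>I. L x (f b) * freeC.representation B (Q x) b)"
    if "b \<in> B" for b
  proof -
    have "f b \<in> W"
      using that BW f(2) by blast
    then have "freeC.representation B (f b) b =
        freeC.representation B (\<Sum>x\<in>I. cscale (L x (f b)) (Q x)) b"
      using rec by simp
    also have "\<dots> = (\<Sum>x\<in>I. freeC.representation B (cscale (L x (f b)) (Q x)) b)"
      using B I(2) by (subst freeC.representation_sum) (auto intro: freeC.span_scale)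
    also have "\<dots> = (\<Sum>x\<in>I. L x (f b) * freeC.representation B (Q x) b)"
      using B I(2) by (intro sum.cong) (auto simp: freeC.representation_scale)
    finally show ?thesis .
  qed
  \<comment> \<open>With \<open>f b\<close> expanded in the family \<open>Q\<close>, the sums are
    exchanged; for fixed \<open>x\<close> the coordinates of \<open>Q x\<close> in \<open>B\<close>
    then reassemble \<open>Q x\<close> inside the linear map \<open>L x \<circ> f\<close>.\<close>
  have "(\<Sum>b\<in>B. freeC.representation B (f b) b) =
      (\<Sum>x\<in>I. \<Sum>b\<in>B. L x (f b) * freeC.representation B (Q x) b)"
    by (subst sum.swap) (simp add: rep)
  also have "\<dots> = (\<Sum>x\<in>I. L x (f (Q x)))"
  proof (rule sum.cong[OF refl])
    fix x assume x: "x \<in> I"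
    interpret L: Vector_Spaces.linear cscale "(*)" "L x" by (rule L)
    have "Q x = (\<Sum>b\<in>B. cscale (freeC.representation B (Q x) b) b)"
      using freeC.sum_representation_eq[OF B(1) _ finB order.refl] B(2) I(2)[OF x] by simp
    then have "L x (f (Q x)) = L x (f (\<Sum>b\<in>B. cscale (freeC.representation B (Q x) b) b))"
      by simp
    then show "(\<Sum>b\<in>B. L x (f b) * freeC.representation B (Q x) b) = L x (f (Q x))"
      by (simp add: f.sum f.scale L.sum L.scale mult.commute)
  qed
  finally show "(\<Sum>b\<in>B. freeC.representation B (f b) b) = (\<Sum>x\<in>I. L x (f (Q x)))" .
qed

section \<open>The action of permutations on tabloid vectors\<close>

text \<open>Serves linearity: the sums for \<open>v\<close>, \<open>w\<close> and
  \<open>v + w\<close> run over different key sets and are brought to a common one.\<close>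

lemma perm_act_superset:
  assumes "finite A" "Poly_Mapping.keys v \<subseteq> A"
  shows "perm_act p v =
    (\<Sum>S\<in>A. Poly_Mapping.single (map ((`) p) S) (Poly_Mapping.lookup v S))"
  unfolding perm_act_def using assms
  by (intro sum.mono_neutral_left) (auto simp: in_keys_iff)

lemma perm_act_add: "perm_act p (v + w) = perm_act p v + perm_act p w"
proof -
  let ?A = "Poly_Mapping.keys v \<union> Poly_Mapping.keys w"
  have "Poly_Mapping.keys (v + w) \<subseteq> ?A"
    by (rule Poly_Mapping.keys_add)
  then show ?thesis
    by (subst (1 2 3) perm_act_superset[of ?A])
      (auto simp: lookup_add single_add sum.distrib)
qed

lemma perm_act_cscale: "perm_act p (cscale c v) = cscale c (perm_act p v)"
proof -
  have "Poly_Mapping.keys (cscale c v) \<subseteq> Poly_Mapping.keys v"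
    by (auto simp: in_keys_iff)
  then have "perm_act p (cscale c v) = (\<Sum>S\<in>Poly_Mapping.keys v.
      Poly_Mapping.single (map ((`) p) S) (c * Poly_Mapping.lookup v S))"
    by (subst perm_act_superset[of "Poly_Mapping.keys v"]) auto
  also have "\<dots> = cscale c (perm_act p v)"
    unfolding perm_act_def freeC.scale_sum_right
    by (intro sum.cong refl poly_mapping_eqI) (auto simp: lookup_single when_def)
  finally show ?thesis .
qed

lemma linear_perm_act: "Vector_Spaces.linear cscale cscale (perm_act p)"
  by unfold_locales (simp_all add: perm_act_add perm_act_cscale)

lemma perm_act_single:
  "perm_act p (Poly_Mapping.single S c) = Poly_Mapping.single (map ((`) p) S) c"
  by (cases "c = 0") (auto simp: perm_act_def)

text \<open>\<open>pair_tabloid n a b\<close> is the basis vector of the tabloid with second row \<open>{a, b}\<close>, and \<open>0\<close>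
  on the diagonal. \<open>pair_proj n a b\<close> is its projection onto the Specht module, seen as the space
  of edge weights on the complete graph whose sum at every vertex vanishes.\<close>

definition pair_tabloid :: "nat \<Rightarrow> nat \<Rightarrow> nat \<Rightarrow> (nat set list \<Rightarrow>\<^sub>0 complex)" where
  "pair_tabloid n a b = (if a = b then 0 else Poly_Mapping.single [{1..n} - {a, b}, {a, b}] 1)"

definition pair_proj :: "nat \<Rightarrow> nat \<Rightarrow> nat \<Rightarrow> (nat set list \<Rightarrow>\<^sub>0 complex)" where
  "pair_proj n a b = pair_tabloid n a b
     - cscale (1 / of_nat (n - 2))
         ((\<Sum>k\<in>{1..n}. pair_tabloid n a k) + (\<Sum>k\<in>{1..n}. pair_tabloid n b k))
     + cscale (1 / of_nat ((n - 1) * (n - 2)))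
         (\<Sum>k\<in>{1..n}. \<Sum>l\<in>{1..n}. pair_tabloid n k l)"

text \<open>The coefficient functionals belonging to the family \<open>pair_proj\<close>. Ordered
  pairs list every tabloid twice, hence the division by 2.\<close>

definition pair_coeff :: "nat \<Rightarrow> nat \<times> nat \<Rightarrow> (nat set list \<Rightarrow>\<^sub>0 complex) \<Rightarrow> complex" where
  "pair_coeff n x w = (if fst x = snd x then 0
     else Poly_Mapping.lookup w [{1..n} - {fst x, snd x}, {fst x, snd x}] / 2)"

lemma pair_tabloid_commute: "pair_tabloid n a b = pair_tabloid n b a"
  by (simp add: pair_tabloid_def insert_commute)

lemma pair_tabloid_same [simp]: "pair_tabloid n a a = 0"
  by (simp add: pair_tabloid_def)

lemma pair_proj_commute: "pair_proj n a b = pair_proj n b a"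
  by (simp add: pair_proj_def add.commute pair_tabloid_commute[of n a b])

lemma perm_act_pair_tabloid:
  assumes "p permutes {1..n}"
  shows "perm_act p (pair_tabloid n a b) = pair_tabloid n (p a) (p b)"
proof -
  have "inj p"
    using assms by (rule permutes_inj)
  have "p ` ({1..n} - {a, b}) = {1..n} - {p a, p b}"
    using assms by (simp add: image_set_diff[OF \<open>inj p\<close>] permutes_image)
  then show ?thesis
    using \<open>inj p\<close> by (auto simp: pair_tabloid_def perm_act_single inj_eq perm_act_def)
qed

text \<open>The correction terms are sums over all vertices, which \<open>p\<close> only
  reindexes.\<close>

lemma perm_act_pair_proj:
  assumes p: "p permutes {1..n}"
  shows "perm_act p (pair_proj n a b) = pair_proj n (p a) (p b)"
proof -
  interpret P: Vector_Spaces.linear cscale cscale "perm_act p" by (rule linear_perm_act)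
  have reindex: "(\<Sum>k\<in>{1..n}. h (p k)) = (\<Sum>k\<in>{1..n}. h k)" for h :: "nat \<Rightarrow> nat set list \<Rightarrow>\<^sub>0 complex"
    using sum.permute[OF p, of h] by (simp add: o_def)
  have inner: "(\<Sum>k\<in>{1..n}. pair_tabloid n c (p k)) = (\<Sum>k\<in>{1..n}. pair_tabloid n c k)" for c
    by (rule reindex)
  have outer: "(\<Sum>k\<in>{1..n}. \<Sum>l\<in>{1..n}. pair_tabloid n (p k) l) = (\<Sum>k\<in>{1..n}. \<Sum>l\<in>{1..n}. pair_tabloid n k l)"
    by (rule reindex)
  show ?thesis
    unfolding pair_proj_def P.add P.diff P.scale P.sum perm_act_pair_tabloid[OF p] inner outer ..
qed

lemma linear_pair_coeff: "Vector_Spaces.linear cscale (*) (pair_coeff n x)"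
  by unfold_locales (simp_all add: pair_coeff_def lookup_add add_divide_distrib algebra_simps)

lemma pair_coeff_pair_tabloid:
  "pair_coeff n (i, j) (pair_tabloid n a b) =
     of_bool (i \<noteq> j) * (of_bool (i = a \<and> j = b) + of_bool (i = b \<and> j = a)) / 2"
  by (auto simp: pair_coeff_def pair_tabloid_def lookup_single when_def doubleton_eq_iff)

subsection \<open>Polytabloids of shape \<open>[n - 2, 2]\<close>\<close>

lemma sum_list_two_rows:
  assumes "n \<ge> (4::nat)"
  shows "sum_list [n - 2, 2] = n"
  using assms by simp

lemma cells_two_rows: "cells [m, 2] = {0} \<times> {..<m} \<union> {1} \<times> {..<2}"
  by (auto simp: cells_def less_Suc_eq nth_Cons split: nat.splits)

lemma tabloid_two_rows:
  assumes t: "tableau [n - 2, 2] t" and n: "n \<ge> 4"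
  shows "tabloid [n - 2, 2] t = [{1..n} - {t (1, 0), t (1, 1)}, {t (1, 0), t (1, 1)}]"
proof -
  have t': "bij_betw t ({0} \<times> {..<n - 2} \<union> {1} \<times> {..<2}) {1..n}"
    using t unfolding tableau_def sum_list_two_rows[OF n] cells_two_rows .
  have row1: "{t (1, j) | j. (1, j) \<in> cells [n - 2, 2]} = {t (1, 0), t (1, 1)}"
    by (auto simp: cells_two_rows less_2_cases_iff)
  have row0: "{t (0, j) | j. (0, j) \<in> cells [n - 2, 2]} = t ` ({0} \<times> {..<n - 2})"
    by (auto simp: cells_two_rows)
  have "t ` ({0} \<times> {..<n - 2}) \<inter> t ` ({1} \<times> {..<2}) = {}"
    using bij_betw_imp_inj_on[OF t'] by (subst inj_on_image_Int[symmetric]) auto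
  moreover have "t ` ({0} \<times> {..<n - 2}) \<union> t ` ({1} \<times> {..<2}) = {1..n}"
    using bij_betw_imp_surj_on[OF t'] by (simp add: image_Un)
  moreover have "t ` ({1} \<times> {..<2}) = {t (1, 0), t (1, 1)}"
    by (auto simp: less_2_cases_iff)
  ultimately have "t ` ({0} \<times> {..<n - 2}) = {1..n} - {t (1, 0), t (1, 1)}"
    by (metis Diff_cancel Un_Diff Diff_triv sup_bot_right)
  then show ?thesis
    using row0 row1 by (simp add: tabloid_def upt_rec)
qed

text \<open>The first two columns are \<open>{a, b}\<close> and \<open>{c, d}\<close>; every other
  column is a single cell or empty. So a stabilizing permutation swaps or fixes each pair
  independently and fixes everything else.\<close>

lemma column_stabilizer_two_rows:
  assumes t: "tableau [n - 2, 2] t" and n: "n \<ge> 4"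
    and abcd: "a = t (0, 0)" "b = t (1, 0)" "c = t (0, 1)" "d = t (1, 1)"
  shows "column_stabilizer [n - 2, 2] t =
    {id, transpose a b, transpose c d, transpose a b \<circ> transpose c d}" (is "_ = ?S")
    and "distinct [a, b, c, d]" "{a, b, c, d} \<subseteq> {1..n}"
proof -
  have t': "bij_betw t ({0} \<times> {..<n - 2} \<union> {1} \<times> {..<2}) {1..n}"
    using t unfolding tableau_def sum_list_two_rows[OF n] cells_two_rows .
  note inj = inj_on_eq_iff[OF bij_betw_imp_inj_on[OF t']]
  show dist: "distinct [a, b, c, d]"
    using n by (simp add: abcd inj)
  show sub: "{a, b, c, d} \<subseteq> {1..n}"
    using bij_betw_apply[OF t'] n by (auto simp: abcd simp del: atLeastAtMost_iff)
  define col where "col j = {t (i, j) | i. (i, j) \<in> cells [n - 2, 2]}" for j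
  have col0: "col 0 = {a, b}" and col1: "col 1 = {c, d}"
    using n by (auto simp: col_def cells_two_rows abcd)
  have col2: "col j = (if j < n - 2 then {t (0, j)} else {})" if "j \<ge> 2" for j
    using that by (auto simp: col_def cells_two_rows)
  have stab: "p \<in> column_stabilizer [n - 2, 2] t \<longleftrightarrow>
      p permutes {1..n} \<and> (\<forall>j. p ` col j = col j)" for p
    unfolding column_stabilizer_def col_def sum_list_two_rows[OF n] by simp
  have other: "\<exists>j\<ge>2. j < n - 2 \<and> x = t (0, j)" if x: "x \<in> {1..n}" "x \<notin> {a, b, c, d}" for x
  proof -
    obtain i j where ij: "(i, j) \<in> {0} \<times> {..<n - 2} \<union> {1} \<times> {..<2}" "x = t (i, j)"
      using x(1) unfolding bij_betw_imp_surj_on[OF t', symmetric] by (elim imageE) (metis surj_pair)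
    have "(i, j) \<notin> {(0, 0), (1, 0), (0, 1), (1, 1)}"
      using x(2) ij(2) unfolding abcd by blast
    then have "i = 0 \<and> j \<noteq> 0 \<and> j \<noteq> 1"
      using ij(1) by (auto simp: less_2_cases_iff)
    then show ?thesis
      using ij by (intro exI[of _ j]) auto
  qed
  have fixed: "t (0, j) \<notin> {a, b, c, d}" if "j \<ge> 2" "j < n - 2" for j
    using that n by (auto simp: abcd inj)
  show "column_stabilizer [n - 2, 2] t = ?S"
  proof (intro equalityI subsetI)
    fix p assume "p \<in> column_stabilizer [n - 2, 2] t"
    then have p: "p permutes {1..n}" "\<And>j. p ` col j = col j"
      by (auto simp: stab)
    have ab: "p a = a \<and> p b = b \<or> p a = b \<and> p b = a"
      using p(2)[of 0] by (simp only: col0 image_insert image_empty doubleton_eq_iff)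
    have cd: "p c = c \<and> p d = d \<or> p c = d \<and> p d = c"
      using p(2)[of 1] by (simp only: col1 image_insert image_empty doubleton_eq_iff)
    have rest: "p x = x" if x: "x \<notin> {a, b, c, d}" for x
    proof (cases "x \<in> {1..n}")
      case True
      then obtain j where j: "j \<ge> 2" "j < n - 2" "x = t (0, j)"
        using other[OF True x] by blast
      then show ?thesis
        using p(2)[of j] col2[of j] by simp
    next
      case False
      then show ?thesis
        using p(1) by (simp add: permutes_not_in)
    qed
    have eqI: "p = q" if "\<And>x. x \<in> {a, b, c, d} \<Longrightarrow> p x = q x" "\<And>x. x \<notin> {a, b, c, d} \<Longrightarrow> q x = x" for q
      using that rest by (metis ext)
    have "p a = a \<and> p b = b \<and> p c = c \<and> p d = d \<Longrightarrow> p = id"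
      by (rule eqI) auto
    moreover have "p a = b \<and> p b = a \<and> p c = c \<and> p d = d \<Longrightarrow> p = transpose a b"
      using dist by (intro eqI) (auto simp: transpose_def)
    moreover have "p a = a \<and> p b = b \<and> p c = d \<and> p d = c \<Longrightarrow> p = transpose c d"
      using dist by (intro eqI) (auto simp: transpose_def)
    moreover have "p a = b \<and> p b = a \<and> p c = d \<and> p d = c \<Longrightarrow> p = transpose a b \<circ> transpose c d"
      using dist by (intro eqI) (auto simp: transpose_def)
    ultimately show "p \<in> ?S"
      using ab cd by blast
  next
    fix p assume p: "p \<in> ?S"
    have "transpose a b permutes {1..n}" "transpose c d permutes {1..n}"
      using sub by (auto intro: permutes_swap_id)
    then have "p permutes {1..n}"
      using p by (auto intro: permutes_compose permutes_id simp: id_def[symmetric])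
    moreover have "p ` col j = col j" for j
    proof -
      consider "j = 0" | "j = 1" | "j \<ge> 2"
        by linarith
      then show ?thesis
      proof cases
        case 1
        then show ?thesis
          using p dist by (auto simp: col0 transpose_def)
      next
        case 2
        then show ?thesis
          using p dist by (auto simp: col1[unfolded One_nat_def] transpose_def)
      next
        case 3
        have "p x = x" if "x \<notin> {a, b, c, d}" for x
          using p that by (auto simp: transpose_def)
        then show ?thesis
          using fixed[OF 3] by (simp add: col2[OF 3])
      qed
    qed
    ultimately show "p \<in> column_stabilizer [n - 2, 2] t"
      by (simp add: stab)
  qed
qed

text \<open>The second row \<open>{b, d}\<close> determines the tabloid, and the four column
  permutations move it with their signs. As edge weights this is the alternating weight on the
  4-cycle \<open>b\<close>, \<open>d\<close>, \<open>a\<close>, \<open>c\<close>, whose sum at every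
  vertex vanishes.\<close>

lemma polytabloid_two_rows:
  assumes t: "tableau [n - 2, 2] t" and n: "n \<ge> 4"
    and abcd: "a = t (0, 0)" "b = t (1, 0)" "c = t (0, 1)" "d = t (1, 1)"
  shows "polytabloid [n - 2, 2] t =
    pair_tabloid n b d - pair_tabloid n a d - pair_tabloid n b c + pair_tabloid n a c"
proof -
  note S = column_stabilizer_two_rows[OF assms]
  have tabloid: "tabloid [n - 2, 2] (p \<circ> t) = [{1..n} - {p b, p d}, {p b, p d}]"
    if "p \<in> column_stabilizer [n - 2, 2] t" for p
  proof -
    have "p permutes {1..n}"
      using that unfolding column_stabilizer_def sum_list_two_rows[OF n] by blast
    then have "tableau [n - 2, 2] (p \<circ> t)"
      using t unfolding tableau_def sum_list_two_rows[OF n]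
      by (blast intro: bij_betw_trans permutes_imp_bij)
    then show ?thesis
      using tabloid_two_rows[OF _ n] abcd by simp
  qed
  have val: "transpose a b a = b" "transpose a b b = a" "transpose a b c = c" "transpose a b d = d"
    "transpose c d a = a" "transpose c d b = b" "transpose c d c = d" "transpose c d d = c"
    using S(2) by (auto simp: transpose_def)
  have ne: "a \<noteq> b" "a \<noteq> c" "a \<noteq> d" "b \<noteq> c" "b \<noteq> d" "c \<noteq> d"
    using S(2) by auto
  have dist: "distinct [id, transpose a b, transpose c d, transpose a b \<circ> transpose c d]"
  proof -
    have "id \<noteq> transpose a b" "id \<noteq> transpose c d" "id \<noteq> transpose a b \<circ> transpose c d"
      "transpose a b \<noteq> transpose c d" "transpose a b \<noteq> transpose a b \<circ> transpose c d"
      "transpose c d \<noteq> transpose a b \<circ> transpose c d"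
      using val ne by (metis comp_apply id_apply)+
    then show ?thesis
      by simp
  qed
  have "polytabloid [n - 2, 2] t = (\<Sum>p\<in>column_stabilizer [n - 2, 2] t.
      Poly_Mapping.single [{1..n} - {p b, p d}, {p b, p d}] (of_int (sign p)))"
    unfolding polytabloid_def by (intro sum.cong) (auto simp: tabloid)
  also have "\<dots> = (\<Sum>p\<in>column_stabilizer [n - 2, 2] t. cscale (of_int (sign p)) (pair_tabloid n (p b) (p d)))"
  proof (intro sum.cong refl)
    fix p assume "p \<in> column_stabilizer [n - 2, 2] t"
    then have "p b \<noteq> p d"
      using ne by (auto simp: column_stabilizer_def dest!: permutes_inj injD)
    then show "Poly_Mapping.single [{1..n} - {p b, p d}, {p b, p d}] (of_int (sign p)) =
        cscale (of_int (sign p)) (pair_tabloid n (p b) (p d))"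
      by (intro poly_mapping_eqI) (simp add: pair_tabloid_def lookup_single when_def)
  qed
  also have "\<dots> = (\<Sum>p\<leftarrow>[id, transpose a b, transpose c d, transpose a b \<circ> transpose c d].
      cscale (of_int (sign p)) (pair_tabloid n (p b) (p d)))"
    using sum.distinct_set_conv_list[OF dist,
        of "\<lambda>p. cscale (of_int (sign p)) (pair_tabloid n (p b) (p d))"]
    unfolding S(1) list.set .
  also have "\<dots> = pair_tabloid n b d - pair_tabloid n a d - pair_tabloid n b c + pair_tabloid n a c"
    using ne by (simp add: val sign_compose permutation_swap_id sign_swap_id)
  finally show ?thesis .
qed

text \<open>Equally many cells and entries are left over, so any bijection between them completes
  the filling.\<close>

lemma ex_tableau_two_rows:
  assumes n: "n \<ge> 4" and dist: "distinct [a, b, c, d]" and sub: "{a, b, c, d} \<subseteq> {1..n}"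
  shows "\<exists>t. tableau [n - 2, 2] t \<and> a = t (0, 0) \<and> b = t (1, 0) \<and> c = t (0, 1) \<and> d = t (1, 1)"
proof -
  let ?D = "{(0, 0), (1, 0), (0, 1), (1, 1)} :: (nat \<times> nat) set"
  have D: "?D \<subseteq> cells [n - 2, 2]"
    using n by (auto simp: cells_two_rows)
  have fin: "finite (cells [n - 2, 2])"
    by (simp add: cells_two_rows)
  have "card (cells [n - 2, 2]) = n"
    using n unfolding cells_two_rows
    by (subst card_Un_disjoint) (auto simp: card_cartesian_product)
  then have "card (cells [n - 2, 2] - ?D) = card ({1..n} - {a, b, c, d})"
    using D fin sub dist by (simp add: card_Diff_subset)
  then obtain h where h: "bij_betw h (cells [n - 2, 2] - ?D) ({1..n} - {a, b, c, d})"
    using finite_same_card_bij[of "cells [n - 2, 2] - ?D" "{1..n} - {a, b, c, d}"] fin by auto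
  define g where "g x = (if x = (0, 0) then a else if x = (1, 0) then b else if x = (0, 1) then c else d)"
    for x :: "nat \<times> nat"
  define t where "t x = (if x \<in> ?D then g x else h x)" for x
  have "bij_betw g ?D {a, b, c, d}"
    using dist by (auto simp: bij_betw_def inj_on_def g_def)
  then have "bij_betw t (?D \<union> (cells [n - 2, 2] - ?D)) ({a, b, c, d} \<union> ({1..n} - {a, b, c, d}))"
    unfolding t_def using h by (intro bij_betw_disjoint_Un) auto
  moreover have "?D \<union> (cells [n - 2, 2] - ?D) = cells [n - 2, 2]"
    using D by blast
  moreover have "{a, b, c, d} \<union> ({1..n} - {a, b, c, d}) = {1..n}"
    using sub by blast
  ultimately have "tableau [n - 2, 2] t"
    unfolding tableau_def sum_list_two_rows[OF n] by simp
  moreover have "t (0, 0) = a" "t (1, 0) = b" "t (0, 1) = c" "t (1, 1) = d"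
    by (simp_all add: t_def g_def)
  ultimately show ?thesis
    by blast
qed

lemma polytabloid_in_specht:
  assumes "n \<ge> 4" "distinct [a, b, c, d]" "{a, b, c, d} \<subseteq> {1..n}"
  shows "pair_tabloid n b d - pair_tabloid n a d - pair_tabloid n b c + pair_tabloid n a c
    \<in> specht [n - 2, 2]"
proof -
  obtain t where t: "tableau [n - 2, 2] t" "a = t (0, 0)" "b = t (1, 0)" "c = t (0, 1)" "d = t (1, 1)"
    using ex_tableau_two_rows[OF assms] by blast
  show ?thesis
    unfolding specht_def using t polytabloid_two_rows[OF t(1) assms(1) t(2-5)]
    by (intro freeC.span_base) force
qed

subsection \<open>The trace on the Specht module\<close>

text \<open>The left side sums the alternating weights of all 4-cycles through the edge
  \<open>ij\<close>, with positive sign at \<open>ij\<close>. The right side is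
  \<open>(n - 1) * (n - 2)\<close> times the formula of \<open>pair_proj\<close>, where
  \<open>n = card V\<close>; the identity is used coefficientwise.\<close>

lemma alternating_sum_identity:
  fixes u :: "'a \<Rightarrow> 'a \<Rightarrow> complex"
  assumes V: "finite V" "i \<in> V" "j \<in> V" "i \<noteq> j"
    and u: "\<And>x y. u x y = u y x" "\<And>x. u x x = 0"
  shows "(\<Sum>k\<in>V - {i, j}. \<Sum>l\<in>V - {i, j} - {k}. u i j - u k j - u i l + u k l) =
    (of_nat (card V) - 1) * (of_nat (card V) - 2) * u i j
    - (of_nat (card V) - 1) * ((\<Sum>k\<in>V. u i k) + (\<Sum>k\<in>V. u j k)) + (\<Sum>k\<in>V. \<Sum>l\<in>V. u k l)"
proof -
  define R where "R = V - {i, j}"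
  define r where "r = (of_nat (card R) :: complex)"
  have R: "finite R" "i \<notin> R" "j \<notin> R" "V = insert i (insert j R)"
    using V by (auto simp: R_def)
  have cardV: "of_nat (card V) = r + 2"
    using R V by (simp add: r_def)
  \<comment> \<open>Splitting \<open>i\<close> and \<open>j\<close> off \<open>V\<close> expresses
    both sides by \<open>u i j\<close>, \<open>r = card V - 2\<close> and these three sums over
    \<open>R\<close>.\<close>
  define Si Sj S where "Si = (\<Sum>k\<in>R. u i k)" and "Sj = (\<Sum>k\<in>R. u j k)" and "S = (\<Sum>k\<in>R. \<Sum>l\<in>R. u k l)"
  have Si': "(\<Sum>k\<in>R. u k i) = Si" and Sj': "(\<Sum>k\<in>R. u k j) = Sj"
    by (simp_all add: Si_def Sj_def u(1)[of _ i] u(1)[of _ j])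
  have inner: "(\<Sum>l\<in>R - {k}. u i j - u k j - u i l + u k l) =
      r * u i j - r * u k j - Si + (\<Sum>l\<in>R. u k l) - u i j + u k j + u i k" if "k \<in> R" for k
  proof -
    have "(\<Sum>l\<in>R - {k}. h l) = (\<Sum>l\<in>R. h l) - h k" for h :: "'a \<Rightarrow> complex"
      using that R(1) by (simp add: sum_diff1)
    then show ?thesis
      by (simp only:) (simp add: sum.distrib sum_subtractf u(2) r_def Si_def right_diff_distrib)
  qed
  have "(\<Sum>k\<in>R. \<Sum>l\<in>R - {k}. u i j - u k j - u i l + u k l) =
      (\<Sum>k\<in>R. r * u i j - r * u k j - Si + (\<Sum>l\<in>R. u k l) - u i j + u k j + u i k)"
    by (intro sum.cong refl inner)
  also have "\<dots> = r * (r - 1) * u i j - (r - 1) * (Si + Sj) + S"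
    by (simp add: sum.distrib sum_subtractf sum_distrib_left[symmetric] Sj' S_def[symmetric]
        Si_def[symmetric] r_def[symmetric] algebra_simps)
  finally have "(\<Sum>k\<in>R. \<Sum>l\<in>R - {k}. u i j - u k j - u i l + u k l) =
      r * (r - 1) * u i j - (r - 1) * (Si + Sj) + S" .
  moreover have "(\<Sum>k\<in>V. u i k) = Si + u i j" "(\<Sum>k\<in>V. u j k) = Sj + u i j"
    "(\<Sum>k\<in>V. \<Sum>l\<in>V. u k l) = S + 2 * Si + 2 * Sj + 2 * u i j"
    using R V by (simp_all add: Si_def[symmetric] Sj_def[symmetric] u(2) sum.distrib Si' Sj' S_def[symmetric] u(1)[of j i])
  ultimately show ?thesis
    unfolding R_def[symmetric] cardV by (simp add: algebra_simps)
qed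

text \<open>\<open>pair_proj\<close> is the average of the polytabloids with positive sign at
  \<open>ij\<close>: there are \<open>(n - 2) * (n - 3)\<close> of them, and their sum is divided by
  \<open>(n - 1) * (n - 2)\<close>, so the average is taken up to a scalar.\<close>

lemma pair_proj_in_specht:
  assumes n: "n \<ge> 4" and ij: "i \<in> {1..n}" "j \<in> {1..n}" "i \<noteq> j"
  shows "pair_proj n i j \<in> specht [n - 2, 2]"
proof -
  let ?R = "{1..n} - {i, j}"
  let ?T = "\<Sum>k\<in>?R. \<Sum>l\<in>?R - {k}. pair_tabloid n i j - pair_tabloid n k j
      - pair_tabloid n i l + pair_tabloid n k l"
  have "pair_proj n i j = cscale (1 / of_nat ((n - 1) * (n - 2))) ?T"
  proof (rule poly_mapping_eqI)
    fix S
    let ?u = "\<lambda>a b. Poly_Mapping.lookup (pair_tabloid n a b) S"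
    have N: "(of_nat n :: complex) - 1 \<noteq> 0" "(of_nat n :: complex) - 2 \<noteq> 0"
      using n by (auto simp: of_nat_eq_iff[of n 1, simplified] of_nat_eq_iff[of n 2, simplified])
    have T: "Poly_Mapping.lookup ?T S =
      (of_nat n - 1) * (of_nat n - 2) * ?u i j
      - (of_nat n - 1) * ((\<Sum>k\<in>{1..n}. ?u i k) + (\<Sum>k\<in>{1..n}. ?u j k)) + (\<Sum>k\<in>{1..n}. \<Sum>l\<in>{1..n}. ?u k l)"
      using alternating_sum_identity[of "{1..n}" i j ?u] ij
      by (simp add: lookup_sum lookup_add lookup_minus pair_tabloid_commute)
    have factor: "A - 1 / (N - 2) * B + 1 / ((N - 1) * (N - 2)) * C =
        1 / ((N - 1) * (N - 2)) * ((N - 1) * (N - 2) * A - (N - 1) * B + C)"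
      if "N - 1 \<noteq> 0" "N - 2 \<noteq> 0" for N A B C :: complex
      using that by (simp add: divide_simps) (simp add: algebra_simps)
    have N': "of_nat ((n - 1) * (n - 2)) = (of_nat n - 1) * (of_nat n - 2 :: complex)"
      using n by (simp add: of_nat_diff)
    have "Poly_Mapping.lookup (pair_proj n i j) S = ?u i j
      - 1 / (of_nat n - 2) * ((\<Sum>k\<in>{1..n}. ?u i k) + (\<Sum>k\<in>{1..n}. ?u j k))
      + 1 / ((of_nat n - 1) * (of_nat n - 2)) * (\<Sum>k\<in>{1..n}. \<Sum>l\<in>{1..n}. ?u k l)"
      using n by (simp add: pair_proj_def lookup_sum lookup_add lookup_minus of_nat_diff)
    then show "Poly_Mapping.lookup (pair_proj n i j) S =
        Poly_Mapping.lookup (cscale (1 / of_nat ((n - 1) * (n - 2))) ?T) S"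
      unfolding lookup_cscale T N' factor[OF N] .
  qed
  moreover have "pair_tabloid n i j - pair_tabloid n k j - pair_tabloid n i l + pair_tabloid n k l
      \<in> specht [n - 2, 2]" if "k \<in> ?R" "l \<in> ?R - {k}" for k l
    using polytabloid_in_specht[OF n, of k i l j] that ij by auto
  ultimately show ?thesis
    unfolding specht_def by (simp only:) (intro freeC.span_scale freeC.span_sum)
qed

text \<open>Only the indices \<open>(a, b)\<close> and \<open>(b, a)\<close> contribute, each with
  coefficient 1/2. Thus the frame sum acts on tabloid vectors as the projection.\<close>

lemma pair_frame_pair_tabloid:
  assumes "a \<in> {1..n}" "b \<in> {1..n}" "a \<noteq> b"
  shows "(\<Sum>x\<in>{1..n} \<times> {1..n}. cscale (pair_coeff n x (pair_tabloid n a b)) (pair_proj n (fst x) (snd x)))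
    = pair_proj n a b"
proof -
  have "cscale (pair_coeff n x (pair_tabloid n a b)) (pair_proj n (fst x) (snd x)) =
      (if x = (a, b) then cscale (1 / 2) (pair_proj n a b) else 0) +
      (if x = (b, a) then cscale (1 / 2) (pair_proj n a b) else 0)" for x
    using assms(3) pair_proj_commute[of n a b]
    by (cases x) (auto simp: pair_coeff_pair_tabloid)
  then have "(\<Sum>x\<in>{1..n} \<times> {1..n}. cscale (pair_coeff n x (pair_tabloid n a b)) (pair_proj n (fst x) (snd x)))
      = cscale (1 / 2) (pair_proj n a b) + cscale (1 / 2) (pair_proj n a b)"
    using assms by (simp add: sum.distrib del: atLeastAtMost_iff)
  also have "\<dots> = pair_proj n a b"
    by (simp add: freeC.scale_left_distrib[symmetric])
  finally show ?thesis .
qed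

text \<open>The frame sum \<open>F\<close> is linear, so being the identity needs checking only on
  the spanning polytabloids.\<close>

lemma pair_frame_specht:
  assumes n: "n \<ge> 4" and w: "w \<in> specht [n - 2, 2]"
  shows "(\<Sum>x\<in>{1..n} \<times> {1..n}. cscale (pair_coeff n x w) (pair_proj n (fst x) (snd x))) = w"
proof -
  define F where "F w = (\<Sum>x\<in>{1..n} \<times> {1..n}. cscale (pair_coeff n x w) (pair_proj n (fst x) (snd x)))" for w
  have lin: "pair_coeff n x (v + w) = pair_coeff n x v + pair_coeff n x w"
    "pair_coeff n x (cscale c v) = c * pair_coeff n x v"
    "pair_coeff n x (v - w) = pair_coeff n x v - pair_coeff n x w" for x v w c
  proof -
    interpret L: Vector_Spaces.linear cscale "(*)" "pair_coeff n x" by (rule linear_pair_coeff)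
    show "pair_coeff n x (v + w) = pair_coeff n x v + pair_coeff n x w"
      "pair_coeff n x (cscale c v) = c * pair_coeff n x v"
      "pair_coeff n x (v - w) = pair_coeff n x v - pair_coeff n x w"
      by (simp_all add: L.add L.scale L.diff)
  qed
  have Fadd: "F (v + w) = F v + F w" and Fdiff: "F (v - w) = F v - F w"
    and Fscale: "F (cscale c v) = cscale c (F v)" for v w c
    by (simp_all add: F_def lin freeC.scale_left_distrib freeC.scale_left_diff_distrib sum.distrib
        sum_subtractf freeC.scale_sum_right)
  have F0: "F 0 = 0"
    using Fscale[of 0 0] by simp
  have "freeC.span {polytabloid [n - 2, 2] t | t. tableau [n - 2, 2] t} \<subseteq> {w. F w = w}"
  proof (rule freeC.span_minimal)
    show "freeC.subspace {w. F w = w}"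
      using F0 by (auto simp: freeC.subspace_def Fadd Fscale)
    show "{polytabloid [n - 2, 2] t | t. tableau [n - 2, 2] t} \<subseteq> {w. F w = w}"
    proof clarify
      fix t assume t: "tableau [n - 2, 2] t"
      define a b c d where abcd: "a = t (0, 0)" "b = t (1, 0)" "c = t (0, 1)" "d = t (1, 1)"
      note S = column_stabilizer_two_rows(2,3)[OF t n abcd]
      have "F (polytabloid [n - 2, 2] t) =
          pair_proj n b d - pair_proj n a d - pair_proj n b c + pair_proj n a c"
        unfolding polytabloid_two_rows[OF t n abcd] Fadd Fdiff using S
        by (simp only: F_def, subst (1 2 3 4) pair_frame_pair_tabloid) auto
      \<comment> \<open>In the alternating combination each of \<open>a\<close>, \<open>b\<close>,
        \<open>c\<close>, \<open>d\<close> occurs once with each sign, so the vertex sums cancel,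
        and so do the total sums.\<close>
      also have "\<dots> = polytabloid [n - 2, 2] t"
        unfolding polytabloid_two_rows[OF t n abcd] pair_proj_def
        by (simp add: freeC.scale_right_distrib algebra_simps)
      finally show "F (polytabloid [n - 2, 2] t) = polytabloid [n - 2, 2] t" .
    qed
  qed
  then show ?thesis
    using w by (auto simp: specht_def F_def)
qed

text \<open>By equivariance the argument is \<open>pair_proj n (p i) (p j)\<close>. The three
  summands are the coefficients at \<open>{i, j}\<close> of its tabloid, of its two vertex sums and
  of its total sum.\<close>

lemma pair_coeff_perm_act_pair_proj:
  assumes n: "n \<ge> 4" and p: "p permutes {1..n}" and ij: "i \<in> {1..n}" "j \<in> {1..n}"
  shows "pair_coeff n (i, j) (perm_act p (pair_proj n i j)) =
    of_bool (i \<noteq> j) * ((of_bool (p i = i) * of_bool (p j = j) + of_bool (p j = i) * of_bool (p i = j)) / 2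
      - (of_bool (p i = i) + of_bool (p i = j) + of_bool (p j = i) + of_bool (p j = j)) / (2 * (of_nat n - 2))
      + 1 / ((of_nat n - 1) * (of_nat n - 2)))"
proof (cases "i = j")
  case True
  then show ?thesis
    by (simp add: pair_coeff_def)
next
  case False
  interpret L: Vector_Spaces.linear cscale "(*)" "pair_coeff n (i, j)" by (rule linear_pair_coeff)
  have star: "(\<Sum>k\<in>{1..n}. pair_coeff n (i, j) (pair_tabloid n a k)) = (of_bool (a = i) + of_bool (a = j)) / 2" for a
  proof -
    have "pair_coeff n (i, j) (pair_tabloid n a k) =
        (if k = j then of_bool (a = i) / 2 else 0) + (if k = i then of_bool (a = j) / 2 else 0)" for k
      using False by (auto simp: pair_coeff_pair_tabloid)
    then show ?thesis
      using ij by (simp add: sum.distrib add_divide_distrib)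
  qed
  \<comment> \<open>The tabloid of \<open>{i, j}\<close> occurs for two ordered pairs, each time
    with coefficient 1/2.\<close>
  have total: "(\<Sum>a\<in>{1..n}. \<Sum>k\<in>{1..n}. pair_coeff n (i, j) (pair_tabloid n a k)) = 1"
    unfolding star using ij
    by (simp add: sum_divide_distrib[symmetric] sum.distrib of_bool_def)
  have self: "pair_coeff n (i, j) (pair_tabloid n (p i) (p j)) =
      (of_bool (p i = i) * of_bool (p j = j) + of_bool (p j = i) * of_bool (p i = j)) / 2"
    by (simp add: False pair_coeff_pair_tabloid of_bool_conj eq_commute[of i "p i"]
        eq_commute[of j "p j"] eq_commute[of i "p j"] eq_commute[of j "p i"])
  have collect: "1 / M * ((x + y) / 2 + (z + w) / 2) = (x + y + z + w) / (2 * M)" for M x y z w :: complex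
    by (simp add: add_divide_distrib)
  have N': "of_nat (n - 2) = (of_nat n - 2 :: complex)"
    "of_nat ((n - 1) * (n - 2)) = (of_nat n - 1) * (of_nat n - 2 :: complex)"
    using n by (simp_all add: of_nat_diff)
  show ?thesis
    unfolding perm_act_pair_proj[OF p] unfolding pair_proj_def L.add L.diff L.scale L.sum total
    unfolding star N' self collect
    using False by simp
qed

text \<open>For a permutation with \<open>a\<close> fixed points and \<open>c\<close> 2-cycles,
  \<open>p \<circ> p\<close> has \<open>a + 2 * c\<close> fixed points, and the value is
  \<open>a * (a - 1) / 2 + c - a\<close>: the permutation character on 2-subsets minus the one on
  points.\<close>

definition specht_char :: "nat \<Rightarrow> (nat \<Rightarrow> nat) \<Rightarrow> complex" where
  "specht_char n p = (of_nat (card {i\<in>{1..n}. p i = i}) ^ 2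
     - 4 * of_nat (card {i\<in>{1..n}. p i = i}) + of_nat (card {i\<in>{1..n}. p (p i) = i})) / 2"

lemma sum_pair_coeff_perm_act:
  assumes n: "n \<ge> 4" and p: "p permutes {1..n}"
  shows "(\<Sum>x\<in>{1..n} \<times> {1..n}. pair_coeff n x (perm_act p (pair_proj n (fst x) (snd x)))) = specht_char n p"
proof -
  define N where "N = (of_nat n :: complex)"
  define \<alpha> \<gamma> where "\<alpha> = (of_nat (card {i\<in>{1..n}. p i = i}) :: complex)"
    and "\<gamma> = (of_nat (card {i\<in>{1..n}. p (p i) = i}) :: complex)"
  define \<delta> where "\<delta> x y = (of_bool (x = y) :: complex)" for x y :: nat
  \<comment> \<open>The summand without the factor \<open>of_bool (i \<noteq> j)\<close>: it is
    summed over the full square, and the diagonal is subtracted afterwards.\<close>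
  define h where "h i j = (\<delta> (p i) i * \<delta> (p j) j + \<delta> (p j) i * \<delta> (p i) j) / 2
      - (\<delta> (p i) i + \<delta> (p i) j + \<delta> (p j) i + \<delta> (p j) j) / (2 * (N - 2))
      + 1 / ((N - 1) * (N - 2))" for i j
  have N: "N - 1 \<noteq> 0" "N - 2 \<noteq> 0"
    using n by (auto simp: N_def of_nat_eq_iff[of n 1, simplified] of_nat_eq_iff[of n 2, simplified])
  have \<alpha>: "(\<Sum>i\<in>{1..n}. \<delta> (p i) i) = \<alpha>"
    by (simp add: \<delta>_def \<alpha>_def of_bool_def sum.If_cases Int_def)
  have \<gamma>: "(\<Sum>i\<in>{1..n}. \<delta> (p (p i)) i) = \<gamma>"
    by (simp add: \<delta>_def \<gamma>_def of_bool_def sum.If_cases Int_def)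
  have one: "(\<Sum>j\<in>{1..n}. \<delta> (p i) j) = 1" if "i \<in> {1..n}" for i
    using permutes_in_image[OF p] that by (simp add: \<delta>_def of_bool_def)
  have pj: "(\<Sum>j\<in>{1..n}. f (p j) * g j) = (\<Sum>j\<in>{1..n}. f j * g (inv p j))" for f g :: "nat \<Rightarrow> complex"
    using sum.permute[OF p, of "\<lambda>j. f j * g (inv p j)"] permutes_inverses[OF p] by (simp add: o_def)
  have one': "(\<Sum>j\<in>{1..n}. \<delta> (p j) i) = 1" if "i \<in> {1..n}" for i
    using pj[of "\<lambda>j. \<delta> j i" "\<lambda>_. 1"] that by (simp add: \<delta>_def of_bool_def)
  \<comment> \<open>Only \<open>j = p i\<close> contributes; here the fixed points of
    \<open>p \<circ> p\<close> enter.\<close>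
  have swap: "(\<Sum>j\<in>{1..n}. \<delta> (p j) i * \<delta> (p i) j) = \<delta> (p (p i)) i" if "i \<in> {1..n}" for i
  proof -
    have "(\<Sum>j\<in>{1..n}. \<delta> (p j) i * \<delta> (p i) j) = (\<Sum>j\<in>{1..n}. if j = p i then \<delta> (p (p i)) i else 0)"
      by (intro sum.cong) (auto simp: \<delta>_def)
    then show ?thesis
      using permutes_in_image[OF p] that by simp
  qed
  have row: "(\<Sum>j\<in>{1..n}. h i j) = (\<delta> (p i) i * \<alpha> + \<delta> (p (p i)) i) / 2
      - (N * \<delta> (p i) i + 2 + \<alpha>) / (2 * (N - 2)) + N / ((N - 1) * (N - 2))"
    if i: "i \<in> {1..n}" for i
    unfolding h_def sum.distrib sum_subtractf sum_divide_distrib[symmetric] sum_distrib_left[symmetric]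
      one[OF i] one'[OF i] swap[OF i] \<alpha> by (simp add: N_def)
  have diag: "h i i = \<delta> (p i) i - 4 * \<delta> (p i) i / (2 * (N - 2)) + 1 / ((N - 1) * (N - 2))" for i
    by (auto simp: h_def \<delta>_def)
  have "(\<Sum>x\<in>{1..n} \<times> {1..n}. pair_coeff n x (perm_act p (pair_proj n (fst x) (snd x)))) =
      (\<Sum>i\<in>{1..n}. \<Sum>j\<in>{1..n}. of_bool (i \<noteq> j) * h i j)"
    unfolding sum.cartesian_product
    using pair_coeff_perm_act_pair_proj[OF n p]
    by (intro sum.cong) (auto simp: h_def \<delta>_def N_def)
  also have "\<dots> = (\<Sum>i\<in>{1..n}. (\<Sum>j\<in>{1..n}. h i j) - h i i)"
  proof (rule sum.cong[OF refl])
    fix i assume i: "i \<in> {1..n}"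
    have "(\<Sum>j\<in>{1..n}. of_bool (i \<noteq> j) * h i j) = (\<Sum>j\<in>{1..n}. h i j - (if j = i then h i i else 0))"
      by (intro sum.cong) auto
    then show "(\<Sum>j\<in>{1..n}. of_bool (i \<noteq> j) * h i j) = (\<Sum>j\<in>{1..n}. h i j) - h i i"
      using i by (simp add: sum_subtractf)
  qed
  also have "\<dots> = (\<Sum>i\<in>{1..n}. (\<delta> (p i) i * \<alpha> + \<delta> (p (p i)) i) / 2
      - (N * \<delta> (p i) i + 2 + \<alpha>) / (2 * (N - 2)) + N / ((N - 1) * (N - 2))
      - (\<delta> (p i) i - 4 * \<delta> (p i) i / (2 * (N - 2)) + 1 / ((N - 1) * (N - 2))))"
    by (intro sum.cong refl) (simp only: row diag)
  also have "\<dots> = (\<alpha> * \<alpha> + \<gamma>) / 2 - (N * \<alpha> + N * (2 + \<alpha>)) / (2 * (N - 2)) + N * N / ((N - 1) * (N - 2))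
      - (\<alpha> - 4 * \<alpha> / (2 * (N - 2)) + N / ((N - 1) * (N - 2)))"
    unfolding sum.distrib sum_subtractf sum_divide_distrib[symmetric] sum_distrib_left[symmetric]
      sum_distrib_right[symmetric] \<alpha> \<gamma> by (simp add: N_def algebra_simps)
  also have "\<dots> = (\<alpha> ^ 2 - 4 * \<alpha> + \<gamma>) / 2"
    using N by (simp add: divide_simps) (simp add: algebra_simps power2_eq_square)
  finally show ?thesis
    by (simp add: specht_char_def \<alpha>_def \<gamma>_def)
qed

text \<open>The trace is defined through a chosen basis, but the frame of the vectors
  \<open>pair_proj\<close> evaluates it for whichever basis is chosen.\<close>

theorem ga_trace_specht_two_rows:
  assumes n: "n \<ge> 4"
  shows "ga_trace n (specht [n - 2, 2]) a = (\<Sum>p | p permutes {1..n}. a p * Const (specht_char n p))"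
proof -
  let ?W = "specht [n - 2, 2]"
  define B where "B = (SOME B. freeC.independent B \<and> freeC.span B = ?W)"
  have sub: "freeC.subspace ?W"
    unfolding specht_def by (rule freeC.subspace_span)
  have "\<exists>B. freeC.independent B \<and> freeC.span B = ?W"
  proof -
    obtain B where "B \<subseteq> ?W" "freeC.independent B" "?W \<subseteq> freeC.span B"
      using freeC.maximal_independent_subset[of ?W] .
    then show ?thesis
      using freeC.span_minimal[OF _ sub, of B] by blast
  qed
  then have B: "freeC.independent B" "freeC.span B = ?W"
    unfolding B_def by (metis (mono_tags, lifting) someI_ex)+
  define I where "I = {x \<in> {1..n} \<times> {1..n}. fst x \<noteq> snd x}"
  have "finite I"
    unfolding I_def by simp
  have I_W: "pair_proj n (fst x) (snd x) \<in> ?W" if "x \<in> I" for x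
    using that by (intro pair_proj_in_specht[OF n]) (auto simp: I_def)
  have off_diag: "pair_coeff n x w = 0" if "x \<in> {1..n} \<times> {1..n} - I" for x w
    using that by (auto simp: I_def pair_coeff_def)
  have rec: "(\<Sum>x\<in>I. cscale (pair_coeff n x w) (pair_proj n (fst x) (snd x))) = w" if "w \<in> ?W" for w
    using pair_frame_specht[OF n that] off_diag
    by (subst sum.mono_neutral_left[of "{1..n} \<times> {1..n}"]) (auto simp: I_def simp del: One_nat_def)
  \<comment> \<open>Invariance is read off the frame: \<open>p\<close> sends each of its vectors to
    another one.\<close>
  have perm_W: "perm_act p ` ?W \<subseteq> ?W" if p: "p permutes {1..n}" for p
  proof clarify
    fix w assume w: "w \<in> ?W"
    interpret P: Vector_Spaces.linear cscale cscale "perm_act p" by (rule linear_perm_act)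
    have "perm_act p w = (\<Sum>x\<in>I. cscale (pair_coeff n x w) (pair_proj n (p (fst x)) (p (snd x))))"
      by (subst rec[OF w, symmetric]) (simp add: P.sum P.scale perm_act_pair_proj[OF p])
    moreover have "pair_proj n (p (fst x)) (p (snd x)) \<in> ?W" if "x \<in> I" for x
      using that permutes_in_image[OF p] inj_eq[OF permutes_inj[OF p]]
      by (intro pair_proj_in_specht[OF n]) (auto simp: I_def simp del: One_nat_def atLeastAtMost_iff)
    ultimately show "perm_act p w \<in> ?W"
      using sub by (auto intro!: freeC.subspace_sum freeC.subspace_scale)
  qed
  have trace: "(\<Sum>b\<in>B. freeC.representation B (perm_act p b) b) = specht_char n p" "finite B"
    if p: "p permutes {1..n}" for p
  proof -
    note frame = sum_representation_frame[OF B \<open>finite I\<close> I_W rec linear_pair_coeff linear_perm_act perm_W[OF p]]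
    show "finite B"
      by (rule frame(2))
    have "(\<Sum>b\<in>B. freeC.representation B (perm_act p b) b) =
        (\<Sum>x\<in>I. pair_coeff n x (perm_act p (pair_proj n (fst x) (snd x))))"
      by (rule frame(1))
    also have "\<dots> = (\<Sum>x\<in>{1..n} \<times> {1..n}. pair_coeff n x (perm_act p (pair_proj n (fst x) (snd x))))"
      using off_diag by (intro sum.mono_neutral_left) (auto simp: I_def)
    finally show "(\<Sum>b\<in>B. freeC.representation B (perm_act p b) b) = specht_char n p"
      using sum_pair_coeff_perm_act[OF n p] by simp
  qed
  have Const_sum: "(\<Sum>b\<in>B. Const (g b)) = Const (\<Sum>b\<in>B. g b)" for g :: "_ \<Rightarrow> complex"
    by (induction B rule: infinite_finite_induct) (auto simp: Const_def single_add)
  have "ga_trace n ?W a = (\<Sum>b\<in>B. \<Sum>p | p permutes {1..n}.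
      a p * Const (freeC.representation B (perm_act p b) b))"
    unfolding ga_trace_def B_def Let_def ..
  also have "\<dots> = (\<Sum>p | p permutes {1..n}. a p * Const (\<Sum>b\<in>B. freeC.representation B (perm_act p b) b))"
    by (subst sum.swap) (simp add: sum_distrib_left[symmetric] Const_sum)
  also have "\<dots> = (\<Sum>p | p permutes {1..n}. a p * Const (specht_char n p))"
    by (intro sum.cong refl) (simp add: trace)
  finally show ?thesis .
qed

section \<open>Coefficients of the trace polynomials\<close>

definition words :: "'a set \<Rightarrow> nat \<Rightarrow> 'a list set" where
  "words E r = {es. set es \<subseteq> E \<and> length es = r}"

definition word_monom :: "'x list \<Rightarrow> ('x \<Rightarrow>\<^sub>0 nat)" where
  "word_monom es = (\<Sum>x\<leftarrow>es. Poly_Mapping.single x 1)"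

definition word_perm :: "nat set list \<Rightarrow> (nat \<Rightarrow> nat)" where
  "word_perm es = foldr (\<lambda>e p. edge_transp e \<circ> p) es id"

lemma finite_words: "finite E \<Longrightarrow> finite (words E r)"
  by (simp add: words_def finite_lists_length_eq)

lemma sum_words_Suc: "(\<Sum>es\<in>words E (Suc r). h es) = (\<Sum>e\<in>E. \<Sum>es\<in>words E r. h (e # es))"
proof -
  have "words E (Suc r) = (\<lambda>(e, es). e # es) ` (E \<times> words E r)"
    by (auto simp: words_def length_Suc_conv)
  moreover have "inj_on (\<lambda>(e, es). e # es) (E \<times> words E r)"
    by (auto simp: inj_on_def)
  ultimately show ?thesis
    by (simp add: sum.reindex sum.cartesian_product case_prod_unfold)
qed

lemma lookup_word_monom: "Poly_Mapping.lookup (word_monom es) x = count_list es x"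
  by (induction es) (auto simp: word_monom_def lookup_add lookup_single when_def)

text \<open>Grouping the pairs \<open>(q, s)\<close> by their product turns the pairing of a product
  with a function on permutations into an iterated pairing.\<close>

lemma sum_ga_mult:
  "(\<Sum>p | p permutes {1..n}. ga_mult n a b p * g p) =
   (\<Sum>q | q permutes {1..n}. a q * (\<Sum>s | s permutes {1..n}. b s * g (q \<circ> s)))"
proof -
  let ?P = "{p. p permutes {1..n}}"
  have fin: "finite ?P"
    by (simp add: finite_permutations)
  have "ga_mult n a b p * g p = (\<Sum>x\<in>{x \<in> ?P \<times> ?P. fst x \<circ> snd x = p}.
      a (fst x) * (b (snd x) * g (fst x \<circ> snd x)))" for p
    unfolding ga_mult_def sum_distrib_right
    by (intro sum.cong) (auto simp: mult.assoc)
  then have "(\<Sum>p\<in>?P. ga_mult n a b p * g p) = (\<Sum>p\<in>?P. \<Sum>x\<in>{x \<in> ?P \<times> ?P. fst x \<circ> snd x = p}.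
      a (fst x) * (b (snd x) * g (fst x \<circ> snd x)))"
    by simp
  also have "\<dots> = (\<Sum>x\<in>?P \<times> ?P. a (fst x) * (b (snd x) * g (fst x \<circ> snd x)))"
    using fin by (intro sum.group) (auto intro: permutes_compose)
  also have "\<dots> = (\<Sum>q\<in>?P. a q * (\<Sum>s\<in>?P. b s * g (q \<circ> s)))"
    by (simp add: sum_distrib_left sum.cartesian_product case_prod_unfold)
  finally show ?thesis .
qed

lemma sum_X_elem:
  assumes E: "finite E" "\<forall>e\<in>E. edge_transp e permutes {1..n}"
  shows "(\<Sum>p | p permutes {1..n}. X_elem E p * g p) = (\<Sum>e\<in>E. Var e * g (edge_transp e))"
proof -
  have fin: "finite {p. p permutes {1..n}}"
    by (simp add: finite_permutations)
  have "(\<Sum>p | p permutes {1..n}. X_elem E p * g p) =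
      (\<Sum>e\<in>E. \<Sum>p | p permutes {1..n}. if edge_transp e = p then Var e * g p else 0)"
    unfolding X_elem_def sum_distrib_right
    by (subst sum.swap) (simp add: when_def if_distrib[of "\<lambda>x. x * _"] cong: if_cong)
  also have "\<dots> = (\<Sum>e\<in>E. Var e * g (edge_transp e))"
    using E fin by (intro sum.cong) auto
  finally show ?thesis .
qed

text \<open>Expanding the power gives one term for each word of \<open>r\<close> edges. The
  induction needs arbitrary \<open>g\<close>, because splitting off the first letter
  \<open>e\<close> replaces \<open>g\<close> by its translate under
  \<open>edge_transp e\<close>.\<close>

lemma sum_ga_power:
  assumes E: "finite E" "\<forall>e\<in>E. edge_transp e permutes {1..n}"
  shows "(\<Sum>p | p permutes {1..n}. ga_power n (X_elem E) r p * Const (g p)) =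
    (\<Sum>es\<in>words E r. Poly_Mapping.single (word_monom es) (g (word_perm es)))"
proof (induction r arbitrary: g)
  case 0
  have fin: "finite {p. p permutes {1..n}}"
    by (simp add: finite_permutations)
  have "(\<Sum>p | p permutes {1..n}. ga_power n (X_elem E) 0 p * Const (g p)) =
      (\<Sum>p | p permutes {1..n}. if p = id then Const (g id) else 0)"
    by (intro sum.cong) (auto simp: ga_power_def ga_one_def when_def)
  also have "\<dots> = Const (g id)"
    using fin permutes_id by simp
  also have "\<dots> = (\<Sum>es\<in>words E 0. Poly_Mapping.single (word_monom es) (g (word_perm es)))"
  proof -
    have "words E 0 = {[]}"
      by (auto simp: words_def)
    then show ?thesis
      by (simp add: word_monom_def word_perm_def Const_def)
  qed
  finally show ?case .
next
  case (Suc r)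
  have ga_Suc: "ga_power n (X_elem E) (Suc r) = ga_mult n (X_elem E) (ga_power n (X_elem E) r)"
    by (simp add: ga_power_def)
  have "(\<Sum>p | p permutes {1..n}. ga_power n (X_elem E) (Suc r) p * Const (g p)) =
      (\<Sum>e\<in>E. Var e * (\<Sum>s | s permutes {1..n}.
        ga_power n (X_elem E) r s * Const (g (edge_transp e \<circ> s))))"
    unfolding ga_Suc sum_ga_mult by (rule sum_X_elem[OF E])
  also have "\<dots> = (\<Sum>e\<in>E. \<Sum>es\<in>words E r.
      Poly_Mapping.single (word_monom (e # es)) (g (word_perm (e # es))))"
    unfolding Suc.IH
    by (simp add: sum_distrib_left Var_def mult_single word_monom_def word_perm_def)
  finally show ?case
    by (simp add: sum_words_Suc)
qed

lemma trace_poly2_words: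
  assumes "n \<ge> 4" "finite E" "\<forall>e\<in>E. edge_transp e permutes {1..n}"
  shows "trace_poly2 n E r =
    (\<Sum>es\<in>words E r. Poly_Mapping.single (word_monom es) (specht_char n (word_perm es)))"
  unfolding trace_poly2_def ga_trace_specht_two_rows[OF assms(1)]
  by (rule sum_ga_power[OF assms(2,3)])

section \<open>Substitution of the edge variables\<close>

lemma poly_subst_add: "poly_subst \<sigma> (P + Q) = poly_subst \<sigma> P + poly_subst \<sigma> Q"
proof -
  let ?h = "\<lambda>P m. Const (Poly_Mapping.lookup P m) *
        (\<Prod>x\<in>Poly_Mapping.keys m. \<sigma> x ^ Poly_Mapping.lookup m x)"
  let ?A = "Poly_Mapping.keys P \<union> Poly_Mapping.keys Q"
  have "poly_subst \<sigma> R = (\<Sum>m\<in>?A. ?h R m)" if "Poly_Mapping.keys R \<subseteq> ?A" for R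
    unfolding poly_subst_def using that
    by (intro sum.mono_neutral_left) (auto simp: in_keys_iff Const_def)
  moreover have "Poly_Mapping.keys (P + Q) \<subseteq> ?A"
    by (rule Poly_Mapping.keys_add)
  ultimately show ?thesis
    by (simp add: sum.distrib lookup_add Const_def single_add distrib_right)
qed

lemma poly_subst_sum: "poly_subst \<sigma> (\<Sum>x\<in>A. P x) = (\<Sum>x\<in>A. poly_subst \<sigma> (P x))"
proof (induction A rule: infinite_finite_induct)
  case (insert x A)
  then show ?case
    by (simp add: poly_subst_add)
qed (simp_all add: poly_subst_def)

lemma prod_list_eq_prod_power_count:
  fixes f :: "'a \<Rightarrow> 'b::comm_monoid_mult"
  assumes "finite A" "set xs \<subseteq> A"
  shows "(\<Prod>x\<leftarrow>xs. f x) = (\<Prod>x\<in>A. f x ^ count_list xs x)"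
  using assms(2)
proof (induction xs)
  case (Cons y xs)
  have "(\<Prod>x\<in>A. f x ^ count_list (y # xs) x) = (\<Prod>x\<in>A. (if x = y then f y else 1) * f x ^ count_list xs x)"
    by (intro prod.cong) auto
  then show ?case
    using Cons assms(1) by (simp add: prod.distrib)
qed simp

lemma poly_subst_word_monom:
  "poly_subst \<sigma> (Poly_Mapping.single (word_monom es) c) = Const c * (\<Prod>x\<leftarrow>es. \<sigma> x)"
proof -
  have mono: "(\<Prod>x\<in>Poly_Mapping.keys (word_monom es). \<sigma> x ^ Poly_Mapping.lookup (word_monom es) x) =
      (\<Prod>x\<leftarrow>es. \<sigma> x)"
  proof -
    have "Poly_Mapping.keys (word_monom es) = set es"
      by (auto simp: in_keys_iff lookup_word_monom count_list_0_iff)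
    then show ?thesis
      by (simp add: lookup_word_monom prod_list_eq_prod_power_count[of "set es"])
  qed
  show ?thesis
    by (cases "c = 0") (simp_all add: poly_subst_def Const_def mono[unfolded Const_def])
qed

lemma prod_list_Var: "Const c * (\<Prod>x\<leftarrow>es. Var (g x)) = Poly_Mapping.single (word_monom (map g es)) c"
proof -
  have "(\<Prod>x\<leftarrow>es. Var (g x)) = Poly_Mapping.single (word_monom (map g es)) (1 :: complex)"
    by (induction es) (simp_all add: word_monom_def Var_def mult_single)
  then show ?thesis
    by (simp add: Const_def mult_single)
qed

text \<open>The words over \<open>E'\<close> are the images under \<open>\<psi>\<close> of the words
  over \<open>E\<close>. The substitution undoes \<open>\<psi>\<close> in the monomials and leaves
  the characters at the image words.\<close>

lemma edge_subst_trace_poly2: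
  assumes n: "n \<ge> 4" and E': "finite E'" "\<forall>e\<in>E'. edge_transp e permutes {1..n}"
    and \<psi>: "bij_betw \<psi> E E'"
  shows "edge_subst \<psi> E (trace_poly2 n E' r) =
    (\<Sum>es\<in>words E r. Poly_Mapping.single (word_monom es) (specht_char n (word_perm (map \<psi> es))))"
proof -
  have inj: "inj_on \<psi> E" and im: "\<psi> ` E = E'"
    using \<psi> by (auto simp: bij_betw_def)
  have inv: "map (inv_into E \<psi>) (map \<psi> es) = es" if "es \<in> words E r" for es
    using that inj by (auto simp: words_def intro!: map_idI)
  have "words E' r = map \<psi> ` words E r"
  proof (intro equalityI subsetI)
    fix es assume es: "es \<in> words E' r"
    have "map \<psi> (map (inv_into E \<psi>) es) = es"
      using es im by (auto simp: words_def f_inv_into_f intro!: map_idI)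
    moreover have "map (inv_into E \<psi>) es \<in> words E r"
      using es im by (auto simp: words_def intro!: inv_into_into)
    ultimately show "es \<in> map \<psi> ` words E r"
      by (metis imageI)
  qed (use im in \<open>fastforce simp: words_def\<close>)
  moreover have "inj_on (map \<psi>) (words E r)"
    using inv by (metis inj_on_inverseI)
  moreover have "edge_subst \<psi> E (trace_poly2 n E' r) = (\<Sum>es\<in>words E' r.
      Poly_Mapping.single (word_monom (map (inv_into E \<psi>) es)) (specht_char n (word_perm es)))"
    unfolding edge_subst_def trace_poly2_words[OF n E'] poly_subst_sum poly_subst_word_monom
    by (simp add: prod_list_Var)
  ultimately show ?thesis
    using inv by (simp add: sum.reindex del: map_map)
qed

section \<open>Comparison of coefficients\<close>

lemma lookup_sum_words:
  assumes "finite E"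
  shows "Poly_Mapping.lookup (\<Sum>es\<in>words E r. Poly_Mapping.single (word_monom es) (h es)) m =
    (\<Sum>es\<in>{es \<in> words E r. word_monom es = m}. h es)"
  using finite_words[OF assms]
  by (simp add: lookup_sum lookup_single when_def sum.inter_filter)

lemma trace_poly2_eq_imp_sum_eq:
  assumes n: "n \<ge> 4" and E: "finite E" "\<forall>e\<in>E. edge_transp e permutes {1..n}"
    and E': "finite E'" "\<forall>e\<in>E'. edge_transp e permutes {1..n}"
    and \<psi>: "bij_betw \<psi> E E'"
    and eq: "edge_subst \<psi> E (trace_poly2 n E' r) = trace_poly2 n E r"
  shows "(\<Sum>es\<in>{es \<in> words E r. word_monom es = m}. specht_char n (word_perm (map \<psi> es))) =
    (\<Sum>es\<in>{es \<in> words E r. word_monom es = m}. specht_char n (word_perm es))"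
  using arg_cong[OF eq, of "\<lambda>P. Poly_Mapping.lookup P m"]
  unfolding edge_subst_trace_poly2[OF n E' \<psi>] trace_poly2_words[OF n E] lookup_sum_words[OF E(1)] .

lemma word_monom_eq_iff: "word_monom es = word_monom fs \<longleftrightarrow> (\<forall>x. count_list es x = count_list fs x)"
  by (simp add: poly_mapping_eq_iff fun_eq_iff lookup_word_monom)

lemma words_monom_2:
  assumes "e \<in> E" "f \<in> E" "e \<noteq> f"
  shows "{es \<in> words E 2. word_monom es = word_monom [e, f]} = {[e, f], [f, e]}"
proof (intro equalityI subsetI)
  fix es assume "es \<in> {es \<in> words E 2. word_monom es = word_monom [e, f]}"
  then have es: "length es = 2" "\<And>x. count_list es x = count_list [e, f] x"
    by (auto simp: words_def word_monom_eq_iff)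
  then obtain a b where "es = [a, b]"
    by (auto simp: numeral_2_eq_2 length_Suc_conv)
  then show "es \<in> {[e, f], [f, e]}"
    using es(2)[of e] es(2)[of f] assms(3) by (auto split: if_splits)
qed (use assms in \<open>auto simp: words_def word_monom_eq_iff\<close>)

text \<open>First come the four words in which equal letters are cyclically adjacent, so that the
  transpositions cancel, then the two alternating words.\<close>

lemma words_monom_4:
  assumes "e \<in> E" "f \<in> E" "e \<noteq> f"
  shows "{es \<in> words E 4. word_monom es = word_monom [e, e, f, f]} =
    {[e, e, f, f], [e, f, f, e], [f, f, e, e], [f, e, e, f], [e, f, e, f], [f, e, f, e]}"
proof (intro equalityI subsetI)
  fix es assume "es \<in> {es \<in> words E 4. word_monom es = word_monom [e, e, f, f]}"
  then have es: "length es = 4" "\<And>x. count_list es x = count_list [e, e, f, f] x"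
    by (auto simp: words_def word_monom_eq_iff)
  then obtain a b c d where abcd: "es = [a, b, c, d]"
    by (auto simp: eval_nat_numeral length_Suc_conv)
  have "set es \<subseteq> {e, f}"
    using es(2) count_list_0_iff[of es] count_list_0_iff[of "[e, e, f, f]"] by force
  then have "a = e \<or> a = f" "b = e \<or> b = f" "c = e \<or> c = f" "d = e \<or> d = f"
    by (auto simp: abcd)
  then show "es \<in> {[e, e, f, f], [e, f, f, e], [f, f, e, e], [f, e, e, f], [e, f, e, f], [f, e, f, e]}"
    using es(2)[of e] assms(3) unfolding abcd by (elim disjE) simp_all
qed (use assms in \<open>auto simp: words_def word_monom_eq_iff\<close>)

subsection \<open>Character values\<close>

lemma edge_transp_doubleton: "a \<noteq> b \<Longrightarrow> edge_transp {a, b} = transpose a b"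
  by (cases a b rule: linorder_cases) (auto simp: edge_transp_def transpose_commute)

lemma edge_transp_involutory [simp]: "edge_transp e (edge_transp e x) = x"
  by (simp add: edge_transp_def)

lemma edge_transp_permutes:
  assumes "e \<subseteq> {1..n}" "card e = 2"
  shows "edge_transp e permutes {1..n}"
proof -
  obtain a b where "e = {a, b}" "a \<noteq> b"
    using assms(2) by (auto simp: card_2_iff)
  then show ?thesis
    using assms(1) by (auto simp: edge_transp_doubleton intro!: permutes_swap_id)
qed

text \<open>\<open>A\<close> and \<open>B\<close> are the points of \<open>{1..n}\<close> moved by
  \<open>p\<close> and by \<open>p \<circ> p\<close>, easier to list than the fixed points.\<close>

lemma specht_charI:
  assumes "{i \<in> {1..n}. p i = i} = {1..n} - A" "{i \<in> {1..n}. p (p i) = i} = {1..n} - B"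
    and "A \<subseteq> {1..n}" "B \<subseteq> {1..n}"
  shows "specht_char n p = ((of_nat n - of_nat (card A)) ^ 2 - 4 * (of_nat n - of_nat (card A))
    + (of_nat n - of_nat (card B))) / 2"
proof -
  have "of_nat (card ({1..n} - C)) = (of_nat n - of_nat (card C) :: complex)" if "C \<subseteq> {1..n}" for C
    using that card_mono[OF _ that] finite_subset[OF that] by (simp add: card_Diff_subset of_nat_diff)
  then show ?thesis
    unfolding specht_char_def assms(1,2) using assms(3,4) by simp
qed

lemma specht_char_id: "specht_char n id = (of_nat n ^ 2 - 3 * of_nat n) / 2"
  by (subst specht_charI[of n id "{}" "{}"]) auto

text \<open>The product moves four points and is an involution: \<open>n - 4\<close> fixed points,
  and \<open>n\<close> for its square.\<close>

lemma specht_char_disjoint: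
  assumes "e \<subseteq> {1..n}" "card e = 2" "f \<subseteq> {1..n}" "card f = 2" "e \<inter> f = {}"
  shows "specht_char n (edge_transp e \<circ> edge_transp f) = (of_nat n ^ 2 - 11 * of_nat n + 32) / 2"
    and "edge_transp e \<circ> edge_transp f \<circ> edge_transp e \<circ> edge_transp f = id"
proof -
  obtain a b where ab: "e = {a, b}" "a \<noteq> b"
    using assms(2) by (auto simp: card_2_iff)
  obtain c d where cd: "f = {c, d}" "c \<noteq> d"
    using assms(4) by (auto simp: card_2_iff)
  have ne: "a \<noteq> c" "a \<noteq> d" "b \<noteq> c" "b \<noteq> d"
    using assms(5) ab cd by auto
  define p where "p = transpose a b \<circ> transpose c d"
  have p: "p i = (if i = a then b else if i = b then a else if i = c then d else if i = d then c else i)" for i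
    using ne ab(2) cd(2) by (auto simp: p_def transpose_def)
  have pp: "p (p i) = i" for i
    using ne ab(2) cd(2) by (simp add: p)
  have ef: "edge_transp e \<circ> edge_transp f = p"
    using ab cd by (simp add: edge_transp_doubleton p_def)
  show "edge_transp e \<circ> edge_transp f \<circ> edge_transp e \<circ> edge_transp f = id"
    using pp by (simp add: ef comp_assoc fun_eq_iff)
  have "{i \<in> {1..n}. p i = i} = {1..n} - {a, b, c, d}"
    using ab(2) cd(2) by (auto simp: p)
  moreover have "{i \<in> {1..n}. p (p i) = i} = {1..n} - {}"
    by (auto simp: pp)
  moreover have "card {a, b, c, d} = 4"
    using ne ab(2) cd(2) by simp
  ultimately show "specht_char n (edge_transp e \<circ> edge_transp f) = (of_nat n ^ 2 - 11 * of_nat n + 32) / 2"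
    unfolding ef using assms(1,3) ab cd
    by (subst specht_charI[of n p "{a, b, c, d}" "{}"]) (auto simp: power2_eq_square algebra_simps)
qed

text \<open>The product is a 3-cycle and its square is the inverse 3-cycle, so both have
  \<open>n - 3\<close> fixed points and the same character value.\<close>

lemma specht_char_adjacent:
  assumes "e \<subseteq> {1..n}" "card e = 2" "f \<subseteq> {1..n}" "card f = 2" "e \<noteq> f" "e \<inter> f \<noteq> {}"
  shows "specht_char n (edge_transp e \<circ> edge_transp f) = (of_nat n ^ 2 - 9 * of_nat n + 18) / 2"
    and "specht_char n (edge_transp e \<circ> edge_transp f \<circ> edge_transp e \<circ> edge_transp f) =
      (of_nat n ^ 2 - 9 * of_nat n + 18) / 2"
proof -
  obtain a where a: "a \<in> e" "a \<in> f"
    using assms(6) by blast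
  obtain b where ab: "e = {a, b}" "a \<noteq> b"
    using card_2_obtain[OF assms(2) a(1)] .
  obtain c where ac: "f = {a, c}" "a \<noteq> c"
    using card_2_obtain[OF assms(4) a(2)] .
  have bc: "b \<noteq> c"
    using assms(5) ab ac by auto
  define p where "p = transpose a b \<circ> transpose a c"
  have p: "p i = (if i = a then c else if i = c then b else if i = b then a else i)" for i
    using ab(2) ac(2) bc by (auto simp: p_def transpose_def)
  have ef: "edge_transp e \<circ> edge_transp f = p"
    using ab ac by (simp add: edge_transp_doubleton p_def)
  have sub: "{a, b, c} \<subseteq> {1..n}" and card: "card {a, b, c} = 3"
    using assms(1,3) ab ac bc by auto
  have fix1: "{i \<in> {1..n}. p i = i} = {1..n} - {a, b, c}"
    using ab(2) ac(2) bc by (auto simp: p)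
  have fix2: "{i \<in> {1..n}. p (p i) = i} = {1..n} - {a, b, c}"
    using ab(2) ac(2) bc by (auto simp: p)
  have fix4: "{i \<in> {1..n}. p (p (p (p i))) = i} = {1..n} - {a, b, c}"
    using ab(2) ac(2) bc by (auto simp: p)
  show "specht_char n (edge_transp e \<circ> edge_transp f) = (of_nat n ^ 2 - 9 * of_nat n + 18) / 2"
    unfolding ef specht_charI[OF fix1 fix2 sub sub] card
    by (simp add: power2_eq_square algebra_simps)
  have "edge_transp e \<circ> edge_transp f \<circ> edge_transp e \<circ> edge_transp f = p \<circ> p"
    by (simp add: ef comp_assoc)
  moreover have "specht_char n (p \<circ> p) = (of_nat n ^ 2 - 9 * of_nat n + 18) / 2"
    using specht_charI[of n "p \<circ> p", OF _ _ sub sub] fix2 fix4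
    by (simp add: card power2_eq_square algebra_simps)
  ultimately show "specht_char n (edge_transp e \<circ> edge_transp f \<circ> edge_transp e \<circ> edge_transp f) =
      (of_nat n ^ 2 - 9 * of_nat n + 18) / 2"
    by simp
qed

text \<open>This is the coefficient at \<open>word_monom [e, f]\<close> in the quadratic trace
  polynomial; its two values differ by \<open>2 * (n - 7)\<close>.\<close>

lemma sum_specht_char_2:
  assumes ef: "e \<subseteq> {1..n}" "card e = 2" "f \<subseteq> {1..n}" "card f = 2" "e \<noteq> f"
  shows "specht_char n (word_perm [e, f]) + specht_char n (word_perm [f, e]) =
    (if e \<inter> f = {} then of_nat n ^ 2 - 11 * of_nat n + 32 else of_nat n ^ 2 - 9 * of_nat n + 18)"
proof (cases "e \<inter> f = {}")
  case True
  then have "f \<inter> e = {}"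
    by blast
  then show ?thesis
    using True ef by (simp add: word_perm_def specht_char_disjoint(1) field_simps)
next
  case False
  then have "f \<inter> e \<noteq> {}"
    by blast
  then show ?thesis
    using False ef by (simp add: word_perm_def specht_char_adjacent(1) field_simps)
qed

text \<open>Four words give the identity. The two alternating ones do so too for disjoint edges, but
  give 3-cycles for adjacent edges; the two values differ by \<open>6 * (n - 3)\<close>.\<close>

lemma sum_specht_char_4:
  assumes ef: "e \<subseteq> {1..n}" "card e = 2" "f \<subseteq> {1..n}" "card f = 2" "e \<noteq> f"
  shows "(\<Sum>es\<leftarrow>[[e, e, f, f], [e, f, f, e], [f, f, e, e], [f, e, e, f], [e, f, e, f], [f, e, f, e]].
      specht_char n (word_perm es)) =
    (if e \<inter> f = {} then 3 * (of_nat n ^ 2 - 3 * of_nat n) else 3 * of_nat n ^ 2 - 15 * of_nat n + 18)"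
proof -
  have ids: "word_perm [e, e, f, f] = id" "word_perm [e, f, f, e] = id"
    "word_perm [f, f, e, e] = id" "word_perm [f, e, e, f] = id"
    by (auto simp: word_perm_def fun_eq_iff)
  have alt: "word_perm [e, f, e, f] = edge_transp e \<circ> edge_transp f \<circ> edge_transp e \<circ> edge_transp f"
    "word_perm [f, e, f, e] = edge_transp f \<circ> edge_transp e \<circ> edge_transp f \<circ> edge_transp e"
    by (auto simp: word_perm_def)
  show ?thesis
  proof (cases "e \<inter> f = {}")
    case True
    then have "f \<inter> e = {}"
      by blast
    then show ?thesis
      using True
      by (simp add: ids alt specht_char_id specht_char_disjoint(2)[OF ef(1-4) True]
          specht_char_disjoint(2)[OF ef(3,4,1,2)])
  next
    case False
    then have "f \<inter> e \<noteq> {}" "f \<noteq> e"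
      using ef(5) by blast+
    then show ?thesis
      using False
      by (simp add: ids alt specht_char_id specht_char_adjacent(2)[OF ef(1-4) ef(5) False]
          specht_char_adjacent(2)[OF ef(3,4,1,2)] field_simps)
  qed
qed

text \<open>For \<open>e = f\<close> both intersections are nonempty, so it suffices to compare
  distinct edges, the only pairs seen by the coefficients.\<close>

lemma line_graph_isoI:
  assumes T: "is_tree V E" and T': "is_tree V' E'" and \<psi>: "bij_betw \<psi> E E'"
    and adj: "\<And>e f. e \<in> E \<Longrightarrow> f \<in> E \<Longrightarrow> e \<noteq> f \<Longrightarrow> e \<inter> f = {} \<longleftrightarrow> \<psi> e \<inter> \<psi> f = {}"
  shows "line_graph_iso \<psi> E E'"
proof -
  have "e \<noteq> {}" "\<psi> e \<noteq> {}" if "e \<in> E" for e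
    using tree_edgeD(2)[OF T that] tree_edgeD(2)[OF T', of "\<psi> e"] bij_betwE[OF \<psi>] that by auto
  then show ?thesis
    using \<psi> adj unfolding line_graph_iso_def by (metis Int_absorb)
qed

section \<open>Reconstruction of the tree from its trace polynomials\<close>

theorem mainTheorem8:
  fixes n :: nat and E E' :: "nat set set"
  assumes "n \<ge> 4"
    and "is_tree {1..n} E"
    and "is_tree {1..n} E'"
  shows "(n \<noteq> 7 \<and>
          (\<exists>\<psi>. bij_betw \<psi> E E' \<and>
               edge_subst \<psi> E (trace_poly2 n E' 2) = trace_poly2 n E 2)
          \<longrightarrow> graph_iso {1..n} E {1..n} E')
       \<and> (n = 7 \<and>
          (\<exists>\<psi>. bij_betw \<psi> E E' \<and>
               edge_subst \<psi> E (trace_poly2 n E' 2) = trace_poly2 n E 2 \<and>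
               edge_subst \<psi> E (trace_poly2 n E' 4) = trace_poly2 n E 4)
          \<longrightarrow> graph_iso {1..n} E {1..n} E')"
proof -
  have fin: "finite E" "finite E'"
    using assms(2,3) finite_subset[of _ "Pow {1..n}"]
    by (auto simp: is_tree_def simple_graph_def subset_iff)
  note E = tree_edgeD[OF assms(2)] and E' = tree_edgeD[OF assms(3)]
  have perm: "\<forall>e\<in>E. edge_transp e permutes {1..n}"
    using edge_transp_permutes E by blast
  have perm': "\<forall>e\<in>E'. edge_transp e permutes {1..n}"
    using edge_transp_permutes E' by blast
  have iso: "graph_iso {1..n} E {1..n} E'"
    if \<psi>: "bij_betw \<psi> E E'"
      and adj: "\<And>e f. e \<in> E \<Longrightarrow> f \<in> E \<Longrightarrow> e \<noteq> f \<Longrightarrow> e \<inter> f = {} \<longleftrightarrow> \<psi> e \<inter> \<psi> f = {}" for \<psi>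
    using line_graph_iso_imp_graph_iso[OF assms(2,3) line_graph_isoI[OF assms(2,3) \<psi> adj]] assms(1)
    by simp
  have \<psi>E: "\<psi> e \<in> E'" "\<psi> f \<in> E'" "\<psi> e \<noteq> \<psi> f"
    if "bij_betw \<psi> E E'" "e \<in> E" "f \<in> E" "e \<noteq> f" for \<psi> e f
    using that by (auto simp: bij_betw_def inj_on_eq_iff)
  have quadratic: "e \<inter> f = {} \<longleftrightarrow> \<psi> e \<inter> \<psi> f = {}"
    if n: "n \<noteq> 7" and \<psi>: "bij_betw \<psi> E E'" and eq: "edge_subst \<psi> E (trace_poly2 n E' 2) = trace_poly2 n E 2"
      and ef: "e \<in> E" "f \<in> E" "e \<noteq> f" for \<psi> e f
  proof -
    note \<psi>ef = \<psi>E[OF \<psi> ef]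
    have "specht_char n (word_perm [\<psi> e, \<psi> f]) + specht_char n (word_perm [\<psi> f, \<psi> e]) =
        specht_char n (word_perm [e, f]) + specht_char n (word_perm [f, e])"
      using trace_poly2_eq_imp_sum_eq[OF assms(1) fin(1) perm fin(2) perm' \<psi> eq, of "word_monom [e, f]"] ef(3)
      unfolding words_monom_2[OF ef] by simp
    \<comment> \<open>The coefficients for disjoint and for adjacent edges coincide exactly at
      \<open>n = 7\<close>; otherwise equal coefficients force the same case for \<open>e\<close>,
      \<open>f\<close> and for their images.\<close>
    moreover have "(of_nat n ^ 2 - 11 * of_nat n + 32 :: complex) \<noteq> of_nat n ^ 2 - 9 * of_nat n + 18"
    proof
      assume "(of_nat n ^ 2 - 11 * of_nat n + 32 :: complex) = of_nat n ^ 2 - 9 * of_nat n + 18"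
      then have "(of_nat n :: complex) = of_nat 7"
        by (simp add: algebra_simps)
      then show False
        using n by (simp only: of_nat_eq_iff)
    qed
    ultimately show ?thesis
      using sum_specht_char_2[OF E[OF ef(1)] E[OF ef(2)] ef(3)]
        sum_specht_char_2[OF E'[OF \<psi>ef(1)] E'[OF \<psi>ef(2)] \<psi>ef(3)]
      by (metis (full_types))
  qed
  have quartic: "e \<inter> f = {} \<longleftrightarrow> \<psi> e \<inter> \<psi> f = {}"
    if \<psi>: "bij_betw \<psi> E E'" and eq: "edge_subst \<psi> E (trace_poly2 n E' 4) = trace_poly2 n E 4"
      and ef: "e \<in> E" "f \<in> E" "e \<noteq> f" for \<psi> e f
  proof -
    note \<psi>ef = \<psi>E[OF \<psi> ef]
    let ?ws = "\<lambda>e f. [[e, e, f, f], [e, f, f, e], [f, f, e, e], [f, e, e, f], [e, f, e, f], [f, e, f, e]]"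
    have dist: "distinct (?ws e f)"
      using ef(3) by simp
    have "(\<Sum>es\<in>set (?ws e f). specht_char n (word_perm (map \<psi> es))) =
        (\<Sum>es\<in>set (?ws e f). specht_char n (word_perm es))"
      using trace_poly2_eq_imp_sum_eq[OF assms(1) fin(1) perm fin(2) perm' \<psi> eq, of "word_monom [e, e, f, f]"]
      unfolding words_monom_4[OF ef] by simp
    then have "(\<Sum>es\<leftarrow>?ws (\<psi> e) (\<psi> f). specht_char n (word_perm es)) =
        (\<Sum>es\<leftarrow>?ws e f. specht_char n (word_perm es))"
      unfolding sum.distinct_set_conv_list[OF dist] by simp
    \<comment> \<open>Here the two values coincide only at \<open>n = 3\<close>, which
      \<open>n \<ge> 4\<close> excludes.\<close>
    moreover have "(3 * (of_nat n ^ 2 - 3 * of_nat n) :: complex) \<noteq> 3 * of_nat n ^ 2 - 15 * of_nat n + 18"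
    proof
      assume "(3 * (of_nat n ^ 2 - 3 * of_nat n) :: complex) = 3 * of_nat n ^ 2 - 15 * of_nat n + 18"
      then have "(of_nat n :: complex) = of_nat 3"
        by (simp add: algebra_simps)
      then have "n = 3"
        by (simp only: of_nat_eq_iff)
      then show False
        using assms(1) by simp
    qed
    ultimately show ?thesis
      unfolding sum_specht_char_4[OF E[OF ef(1)] E[OF ef(2)] ef(3)]
        sum_specht_char_4[OF E'[OF \<psi>ef(1)] E'[OF \<psi>ef(2)] \<psi>ef(3)]
      by (metis (full_types))
  qed
  show ?thesis
    using iso quadratic quartic by blast
qed

end
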